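(* Suppose Assumptions (A) and (B) (stated in the context) hold. If either $s_2=o(n/(\kappa_n\gamma_n))$ or Assumption (C) (stated in the context) holds, then, for every fixed $C>0$, with probability going to one there exists a unique estimator $\hat{\boldsymbol\beta}_n\in B_C(\boldsymbol\beta^\star)$ such that $\varphi_n(\hat{\boldsymbol\beta}_n)=0$, and $\hat{\boldsymbol\beta}_n\to\boldsymbol\beta^\star$ in probability as $n\to\infty$.
   Context: Notation: $a_n\ll b_n$ (equivalently $b_n\gg a_n$) means $a_n=o(b_n)$; all limits are as $n\to\infty$; "with probability going to one" means on events whose probability tends to 1. Model: $d\ge 1$ is a fixed integer. For each $n$ the data satisfy $Y_i=\mu_i^\star+\boldsymbol X_i^T\boldsymbol\beta^\star+\epsilon_i$, $1\le i\le n$, where $\boldsymbol\beta^\star\in\mathbb R^d$ and $\boldsymbol\mu^\star=(\mu_1^\star,\dots,\mu_n^\star)^T$ are deterministic ($\boldsymbol\mu^\star$ may vary with $n$). The $\boldsymbol X_i$ are i.i.d. copies of a random vector $\boldsymbol X_0\in\mathbb R^d$ with mean zero and positive definite covariance matrix $\boldsymbol\Sigma_X$; they are independent of the $\epsilon_i$, which are i.i.d. copies of a random variable $\epsilon_0$ with mean zero and variance $\sigma^2>0$. $\boldsymbol X$ is the $n\times d$ matrix with rows $\boldsymbol X_i^T$ and $\boldsymbol Y=(Y_1,\dots,Y_n)^T$. Assumption (A): there are positive sequences $\kappa_n\ll\sqrt n$, $\gamma_n\ll\sqrt n$ with $P(\max_{1\le i\le n}\|\boldsymbol X_i\|_2>\kappa_n)\to0$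 and $P(\max_{1\le i\le n}|\epsilon_i|>\gamma_n)\to0$. Incidental parameters: with $s=s_1+s_2$ and $s_1+s_2=o(n)$: $|\mu_i^\star|\gg\max\{\kappa_n,\gamma_n\}$ for $1\le i\le s_1$; $0<|\mu_i^\star|\le\gamma_n$ for $s_1+1\le i\le s$; $\mu_i^\star=0$ for $s+1\le i\le n$. Let $\boldsymbol\mu_2^\star=(\mu_{s_1+1}^\star,\dots,\mu_s^\star)^T$ and $\mu^\star=\min_{1\le i\le s_1}|\mu_i^\star|$. Assumption (B): the regularization parameter $\lambda=\lambda_n>0$ satisfies $\kappa_n\ll\lambda$, $\alpha\gamma_n\le\lambda$ for a constant $\alpha>2$, and $\lambda\ll\min\{\mu^\star,\sqrt n\}$. Assumption (C): there is a constant $\delta>0$ such that $E\|\boldsymbol X_0\|_2^{2+\delta}<\infty$ and $\|\boldsymbol\mu_2^\star\|_2/\|\boldsymbol\mu_2^\star\|_{2+\delta}\to\infty$, where $\|\boldsymbol\mu_2^\star\|_{2+\delta}=(\sum_{i=s_1+1}^{s}|\mu_i^\star|^{2+\delta})^{1/(2+\delta)}$. Estimating function: $\varphi_n(\boldsymbol\beta)=\boldsymbol\beta-(\boldsymbol X^T\boldsymbol X)^{-1}\boldsymbol X^T(\boldsymbol Y-\boldsymbol\mu(\boldsymbol\beta))$, where $\boldsymbol\mu(\boldsymbol\beta)\in\mathbb R^n$ has components $\mu_i(\boldsymbol\beta)=(|Y_i-\boldsymbol X_i^T\boldsymbol\beta|-\lambda)_+\,\mathrm{sign}(Y_i-\boldsymbol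 X_i^T\boldsymbol\beta)$. $B_C(\boldsymbol\beta^\star)=\{\boldsymbol\beta\in\mathbb R^d:|\beta_j-\beta_j^\star|\le C,\ 1\le j\le d\}$. *)

theory Defs
  imports "HOL-Probability.Probability"
begin

definition covariance_matrix :: "'a measure \<Rightarrow> ('a \<Rightarrow> real ^ 'd) \<Rightarrow> real ^ 'd ^ 'd" where
  "covariance_matrix M Z =
     (\<chi> j k. \<integral>\<omega>. (Z \<omega> $ j - (\<integral>\<omega>'. Z \<omega>' $ j \<partial>M)) * (Z \<omega> $ k - (\<integral>\<omega>'. Z \<omega>' $ k \<partial>M)) \<partial>M)"

definition positive_definite :: "real ^ 'd ^ 'd \<Rightarrow> bool" where
  "positive_definite S \<longleftrightarrow> transpose S = S \<and> (\<forall>v. v \<noteq> 0 \<longrightarrow> v \<bullet> (S *v v) > 0)"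

(* The sigma-algebra generated by the finite family (Z i), i in I. *)
definition sigma_generated ::
  "'a measure \<Rightarrow> 'i set \<Rightarrow> ('i \<Rightarrow> 'a \<Rightarrow> 'b::topological_space) \<Rightarrow> 'a set set" where
  "sigma_generated M I Z =
     sets (vimage_algebra (space M) (\<lambda>\<omega>. \<lambda>i\<in>I. Z i \<omega>) (\<Pi>\<^sub>M i\<in>I. borel))"

(* The n x d design matrix has rows x 1, ..., x n.  As n is not a type, X^T X and X^T v are
   written as sums over the rows. *)
definition gram :: "nat \<Rightarrow> (nat \<Rightarrow> real ^ 'd) \<Rightarrow> real ^ 'd ^ 'd" where
  "gram n x = (\<chi> j k. \<Sum>i=1..n. x i $ j * x i $ k)"

definition transpose_mult :: "nat \<Rightarrow> (nat \<Rightarrow> real ^ 'd) \<Rightarrow> (nat \<Rightarrow> real) \<Rightarrow> real ^ 'd" where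
  "transpose_mult n x v = (\<chi> j. \<Sum>i=1..n. x i $ j * v i)"

definition mu_fun ::
  "real \<Rightarrow> (nat \<Rightarrow> real ^ 'd) \<Rightarrow> (nat \<Rightarrow> real) \<Rightarrow> real ^ 'd \<Rightarrow> nat \<Rightarrow> real" where
  "mu_fun lam x y b i = max 0 (\<bar>y i - x i \<bullet> b\<bar> - lam) * sgn (y i - x i \<bullet> b)"

(* Meaningful only when gram n x is invertible. *)
definition phi ::
  "nat \<Rightarrow> real \<Rightarrow> (nat \<Rightarrow> real ^ 'd) \<Rightarrow> (nat \<Rightarrow> real) \<Rightarrow> real ^ 'd \<Rightarrow> real ^ 'd" where
  "phi n lam x y b =
     b - matrix_inv (gram n x) *v transpose_mult n x (\<lambda>i. y i - mu_fun lam x y b i)"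

definition coord_box :: "real \<Rightarrow> real ^ 'd \<Rightarrow> (real ^ 'd) set" where
  "coord_box C b0 = {b. \<forall>j. \<bar>b $ j - b0 $ j\<bar> \<le> C}"

(* Extended-real valued, so that the minimum over an empty index set (s1 = 0) is infinity. *)
definition mu_min :: "nat \<Rightarrow> (nat \<Rightarrow> real) \<Rightarrow> ereal" where
  "mu_min s1 m = (INF i\<in>{1..s1}. ereal \<bar>m i\<bar>)"

definition lp_norm_on :: "real \<Rightarrow> nat set \<Rightarrow> (nat \<Rightarrow> real) \<Rightarrow> real" where
  "lp_norm_on p I m = (\<Sum>i\<in>I. \<bar>m i\<bar> powr p) powr (1 / p)"

end

theory Submission
  imports Defs
begin

text \<open>
  The estimating equation \<open>phi b = 0\<close> says that \<open>\<Sum>i. psi (y i - x i \<bullet> b) *\<^sub>R x i = 0\<close>, where \<open>psi\<close>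
  clips to \<open>[- lam, lam]\<close>. On the event where the design vectors are bounded by \<open>kappa\<close> and the
  errors by \<open>gamma\<close>, the clipping inside the box is decided by \<open>i\<close> alone: it is active, with sign
  \<open>sgn (mu i)\<close>, exactly for \<open>i \<le> s1\<close>. So the equation becomes the linear system \<open>S (b - beta_star) = V\<close>
  with \<open>S = (\<Sum>i>s1. x i (x i)\<^sup>T)\<close> and \<open>V = (\<Sum>i. w i *\<^sub>R x i)\<close>, where \<open>w i = lam * sgn (mu i)\<close> for
  \<open>i \<le> s1\<close> and \<open>w i = mu i + eps i\<close> otherwise. By Chebyshev's inequality \<open>S / n\<close> tends to the
  covariance matrix; and as the summands of \<open>V\<close> are centred, uncorrelated and have second moments
  \<open>O(lam\<^sup>2 + 1) = o(n)\<close>, \<open>V / n\<close> tends to \<open>0\<close>.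
\<close>

section \<open>Second-moment inequalities and vanishing integrals\<close>

lemma integrable_mult_if_squares:
  fixes f g :: "'a \<Rightarrow> real"
  assumes "f \<in> borel_measurable M" "g \<in> borel_measurable M"
    and "integrable M (\<lambda>\<omega>. (f \<omega>)\<^sup>2)" "integrable M (\<lambda>\<omega>. (g \<omega>)\<^sup>2)"
  shows "integrable M (\<lambda>\<omega>. f \<omega> * g \<omega>)"
proof (rule Bochner_Integration.integrable_bound)
  show "integrable M (\<lambda>\<omega>. (f \<omega>)\<^sup>2 + (g \<omega>)\<^sup>2)"
    using assms by auto
  show "(\<lambda>\<omega>. f \<omega> * g \<omega>) \<in> borel_measurable M"
    using assms by auto
  have "\<bar>a * b\<bar> \<le> a\<^sup>2 + b\<^sup>2" for a b :: real
  proof -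
    have "2 * \<bar>a * b\<bar> \<le> a\<^sup>2 + b\<^sup>2"
      using sum_squares_bound[of "\<bar>a\<bar>" "\<bar>b\<bar>"] by (simp add: abs_mult)
    then show ?thesis by linarith
  qed
  then show "AE \<omega> in M. norm (f \<omega> * g \<omega>) \<le> norm ((f \<omega>)\<^sup>2 + (g \<omega>)\<^sup>2)"
    by auto
qed

text \<open>The cross terms vanish in the expectation of the squared sum, so only the diagonal is
  left, and Markov's inequality for the square does the rest. Asking for orthogonality instead of
  independence lets one bound serve both the truncated products of the design and the error-weighted
  design.\<close>

lemma (in prob_space) prob_abs_sum_uncorrelated:
  fixes Z :: "'i \<Rightarrow> 'a \<Rightarrow> real"
  assumes I: "finite I"
    and meas: "\<And>i. i \<in> I \<Longrightarrow> Z i \<in> borel_measurable M"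
    and sq: "\<And>i. i \<in> I \<Longrightarrow> integrable M (\<lambda>\<omega>. (Z i \<omega>)\<^sup>2)"
    and uncor: "\<And>i k. i \<in> I \<Longrightarrow> k \<in> I \<Longrightarrow> i \<noteq> k \<Longrightarrow> expectation (\<lambda>\<omega>. Z i \<omega> * Z k \<omega>) = 0"
    and B: "\<And>i. i \<in> I \<Longrightarrow> expectation (\<lambda>\<omega>. (Z i \<omega>)\<^sup>2) \<le> B"
    and t: "t > 0"
  shows "prob {\<omega> \<in> space M. \<bar>\<Sum>i\<in>I. Z i \<omega>\<bar> > t} \<le> real (card I) * B / t\<^sup>2"
proof -
  have int: "integrable M (\<lambda>\<omega>. Z i \<omega> * Z k \<omega>)" if "i \<in> I" "k \<in> I" for i k
    using that meas sq by (intro integrable_mult_if_squares)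
  have expand: "(\<lambda>\<omega>. (\<Sum>i\<in>I. Z i \<omega>)\<^sup>2) = (\<lambda>\<omega>. \<Sum>i\<in>I. \<Sum>k\<in>I. Z i \<omega> * Z k \<omega>)"
    by (simp add: power2_eq_square sum_product)
  have "expectation (\<lambda>\<omega>. (\<Sum>i\<in>I. Z i \<omega>)\<^sup>2) =
      (\<Sum>i\<in>I. \<Sum>k\<in>I. expectation (\<lambda>\<omega>. Z i \<omega> * Z k \<omega>))"
    unfolding expand using int by (simp add: Bochner_Integration.integral_sum)
  also have "\<dots> = (\<Sum>i\<in>I. \<Sum>k\<in>I. if k = i then expectation (\<lambda>\<omega>. (Z i \<omega>)\<^sup>2) else 0)"
    by (intro sum.cong) (auto simp: uncor power2_eq_square)
  also have "\<dots> \<le> (\<Sum>i\<in>I. B)"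
    using I B by (intro sum_mono) (simp add: sum.delta)
  finally have E: "expectation (\<lambda>\<omega>. (\<Sum>i\<in>I. Z i \<omega>)\<^sup>2) \<le> real (card I) * B"
    by simp
  have "integrable M (\<lambda>\<omega>. (\<Sum>i\<in>I. Z i \<omega>)\<^sup>2)"
    unfolding expand using int by auto
  then have "prob {\<omega> \<in> space M. (\<Sum>i\<in>I. Z i \<omega>)\<^sup>2 \<ge> t\<^sup>2}
      \<le> expectation (\<lambda>\<omega>. (\<Sum>i\<in>I. Z i \<omega>)\<^sup>2) / t\<^sup>2"
    using t by (intro integral_Markov_inequality_measure[where A = "{}"]) auto
  also have "\<dots> \<le> real (card I) * B / t\<^sup>2"
    using E t by (simp add: divide_right_mono)
  finally have *: "prob {\<omega> \<in> space M. (\<Sum>i\<in>I. Z i \<omega>)\<^sup>2 \<ge> t\<^sup>2} \<le> real (card I) * B / t\<^sup>2" .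
  have "prob {\<omega> \<in> space M. \<bar>\<Sum>i\<in>I. Z i \<omega>\<bar> > t} \<le> prob {\<omega> \<in> space M. (\<Sum>i\<in>I. Z i \<omega>)\<^sup>2 \<ge> t\<^sup>2}"
  proof (rule finite_measure_mono)
    show "{\<omega> \<in> space M. (\<Sum>i\<in>I. Z i \<omega>)\<^sup>2 \<ge> t\<^sup>2} \<in> events"
      using meas by measurable
    show "{\<omega> \<in> space M. \<bar>\<Sum>i\<in>I. Z i \<omega>\<bar> > t} \<subseteq> {\<omega> \<in> space M. (\<Sum>i\<in>I. Z i \<omega>)\<^sup>2 \<ge> t\<^sup>2}"
      using t by (auto simp: abs_le_square_iff[symmetric])
  qed
  with * show ?thesis by linarith
qed

text \<open>Absolute continuity of the integral, by splitting the absolute value of \<open>f\<close>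
  at a height \<open>K\<close>: the part above \<open>K\<close> has small integral by dominated
  convergence, and the rest contributes at most \<open>K\<close> times the measure of
  \<open>A n\<close>. This later removes the truncation from the second moments of the
  design.\<close>

lemma (in finite_measure) integral_tendsto_0_if_measure_tendsto_0:
  fixes f :: "'a \<Rightarrow> real"
  assumes f: "integrable M f" and A: "\<And>n. A n \<in> sets M"
    and lim: "(\<lambda>n. measure M (A n)) \<longlonglongrightarrow> 0"
  shows "(\<lambda>n. \<integral>\<omega>. f \<omega> * indicator (A n) \<omega> \<partial>M) \<longlonglongrightarrow> 0"
proof (rule LIMSEQ_I)
  fix e :: real assume e: "e > 0"
  have [measurable]: "f \<in> borel_measurable M" "\<And>n. A n \<in> sets M"
    using f A by auto
  define t where "t K \<omega> = \<bar>f \<omega>\<bar> * indicator {\<omega> \<in> space M. \<bar>f \<omega>\<bar> > real K} \<omega>" for K :: nat and \<omega>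
  have [measurable]: "t K \<in> borel_measurable M" for K
    unfolding t_def by measurable
  have "(\<lambda>K. \<integral>\<omega>. t K \<omega> \<partial>M) \<longlonglongrightarrow> (\<integral>\<omega>. 0 \<partial>M)"
  proof (rule integral_dominated_convergence[where w = "\<lambda>\<omega>. \<bar>f \<omega>\<bar>"])
    show "AE \<omega> in M. (\<lambda>K. t K \<omega>) \<longlonglongrightarrow> 0"
    proof (rule AE_I2)
      fix \<omega>
      obtain K0 where "\<bar>f \<omega>\<bar> < real K0" using reals_Archimedean2 by blast
      then have "eventually (\<lambda>K. t K \<omega> = 0) sequentially"
        by (intro eventually_sequentiallyI[of K0]) (auto simp: t_def indicator_def)
      then show "(\<lambda>K. t K \<omega>) \<longlonglongrightarrow> 0" by (rule tendsto_eventually)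
    qed
  qed (use f in \<open>auto simp: t_def indicator_def\<close>)
  then have "eventually (\<lambda>K. (\<integral>\<omega>. t K \<omega> \<partial>M) < e / 2) sequentially"
    using e by (intro order_tendstoD(2)) auto
  then obtain K where K: "(\<integral>\<omega>. t K \<omega> \<partial>M) < e / 2"
    by (auto simp: eventually_sequentially)
  have tint: "integrable M (t K)"
    by (rule Bochner_Integration.integrable_bound[OF f]) (auto simp: t_def indicator_def)
  have bound: "\<bar>\<integral>\<omega>. f \<omega> * indicator (A n) \<omega> \<partial>M\<bar> \<le> (\<integral>\<omega>. t K \<omega> \<partial>M) + real K * measure M (A n)" for n
  proof -
    have "\<bar>\<integral>\<omega>. f \<omega> * indicator (A n) \<omega> \<partial>M\<bar> \<le> (\<integral>\<omega>. \<bar>f \<omega> * indicator (A n) \<omega>\<bar> \<partial>M)"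
      by simp
    also have "\<dots> \<le> (\<integral>\<omega>. t K \<omega> + real K * indicator (A n) \<omega> \<partial>M)"
    proof (rule integral_mono)
      show "integrable M (\<lambda>\<omega>. \<bar>f \<omega> * indicator (A n) \<omega>\<bar>)"
        using f A by (intro integrable_abs integrable_real_mult_indicator)
      show "integrable M (\<lambda>\<omega>. t K \<omega> + real K * indicator (A n) \<omega>)"
        using tint by (intro Bochner_Integration.integrable_add integrable_mult_right
            integrable_real_indicator) (auto simp: less_top[symmetric])
    qed (auto simp: t_def indicator_def)
    also have "\<dots> = (\<integral>\<omega>. t K \<omega> \<partial>M) + real K * measure M (A n)"
      using tint A by (subst Bochner_Integration.integral_add)
        (auto simp: less_top[symmetric] intro!: integrable_mult_right integrable_real_indicator)
    finally show ?thesis .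
  qed
  have "(\<lambda>n. real K * measure M (A n)) \<longlonglongrightarrow> 0"
    using tendsto_mult_right_zero[OF lim] by simp
  then have "eventually (\<lambda>n. real K * measure M (A n) < e / 2) sequentially"
    using e by (intro order_tendstoD(2)) auto
  then obtain N where N: "\<And>n. n \<ge> N \<Longrightarrow> real K * measure M (A n) < e / 2"
    by (auto simp: eventually_sequentially)
  show "\<exists>N. \<forall>n\<ge>N. norm ((\<integral>\<omega>. f \<omega> * indicator (A n) \<omega> \<partial>M) - 0) < e"
  proof (intro exI allI impI)
    fix n assume "n \<ge> N"
    from N[OF this] K bound[of n]
    show "norm ((\<integral>\<omega>. f \<omega> * indicator (A n) \<omega> \<partial>M) - 0) < e" by simp
  qed
qed

section \<open>Coercive matrices and Gram matrices\<close>

text \<open>The quadratic form is continuous, so it attains a minimum on the compact unit sphere;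
  that minimum is positive and serves as \<open>c\<close>, and homogeneity of degree two carries the
  bound to all vectors.\<close>

lemma positive_definite_lower_bound:
  fixes S :: "real ^ 'd ^ 'd"
  assumes "positive_definite S"
  obtains c where "c > 0" "\<And>v. c * (norm v)\<^sup>2 \<le> v \<bullet> (S *v v)"
proof -
  have cont: "continuous_on (sphere 0 1) (\<lambda>v. v \<bullet> (S *v v))"
    by (intro continuous_intros)
  have "sphere (0 :: real ^ 'd) 1 \<noteq> {}" by simp
  then obtain u where u: "u \<in> sphere 0 1"
    and min: "\<And>v. v \<in> sphere 0 1 \<Longrightarrow> u \<bullet> (S *v u) \<le> v \<bullet> (S *v v)"
    using continuous_attains_inf[OF compact_sphere _ cont] by blast
  show thesis
  proof
    show "u \<bullet> (S *v u) > 0"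
    proof -
      from u have "u \<noteq> 0" by auto
      with assms show ?thesis by (simp add: positive_definite_def)
    qed
    fix v :: "real ^ 'd"
    show "u \<bullet> (S *v u) * (norm v)\<^sup>2 \<le> v \<bullet> (S *v v)"
    proof (cases "v = 0")
      case False
      define w where "w = (1 / norm v) *\<^sub>R v"
      have v: "v = norm v *\<^sub>R w" using False by (simp add: w_def)
      have "w \<in> sphere 0 1" using False by (simp add: w_def)
      then have "u \<bullet> (S *v u) * (norm v)\<^sup>2 \<le> (w \<bullet> (S *v w)) * (norm v)\<^sup>2"
        using min by (intro mult_right_mono) auto
      also have "\<dots> = v \<bullet> (S *v v)"
        using arg_cong[OF v, of "\<lambda>x. x \<bullet> (S *v x)"]
        by (simp add: matrix_vector_mult_scaleR power2_eq_square)
      finally show ?thesis .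
    qed simp
  qed
qed

text \<open>Index sets other than \<open>{1..n}\<close> occur because the rows whose residuals are
  clipped drop out of the linear system.\<close>

definition gram_on :: "nat set \<Rightarrow> (nat \<Rightarrow> real ^ 'd) \<Rightarrow> real ^ 'd ^ 'd" where
  "gram_on I x = (\<chi> j k. \<Sum>i\<in>I. x i $ j * x i $ k)"

lemma gram_eq_gram_on: "gram n x = gram_on {1..n} x"
  by (simp add: gram_def gram_on_def)

lemma gram_on_mult_vec: "gram_on I x *v u = (\<Sum>i\<in>I. (x i \<bullet> u) *\<^sub>R x i)"
proof (rule vec_eq_iff[THEN iffD2], intro allI)
  fix j
  have "(gram_on I x *v u) $ j = (\<Sum>k\<in>UNIV. \<Sum>i\<in>I. x i $ j * x i $ k * u $ k)"
    by (simp add: gram_on_def matrix_vector_mult_def sum_distrib_right)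
  also have "\<dots> = (\<Sum>i\<in>I. \<Sum>k\<in>UNIV. x i $ j * x i $ k * u $ k)"
    by (rule sum.swap)
  also have "\<dots> = (\<Sum>i\<in>I. (x i \<bullet> u) *\<^sub>R x i) $ j"
    by (simp add: inner_vec_def sum_distrib_left sum_distrib_right mult_ac)
  finally show "(gram_on I x *v u) $ j = (\<Sum>i\<in>I. (x i \<bullet> u) *\<^sub>R x i) $ j" .
qed

lemma inner_gram_on: "u \<bullet> (gram_on I x *v u) = (\<Sum>i\<in>I. (x i \<bullet> u)\<^sup>2)"
  by (simp add: gram_on_mult_vec inner_sum_right power2_eq_square inner_commute)

lemma transpose_mult_eq_sum: "transpose_mult n x v = (\<Sum>i=1..n. v i *\<^sub>R x i)"
  by (simp add: transpose_mult_def vec_eq_iff mult.commute)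

lemma coercive_invertible:
  fixes A :: "real ^ 'd ^ 'd"
  assumes "c > 0" "\<And>v. c * (norm v)\<^sup>2 \<le> v \<bullet> (A *v v)"
  shows "invertible A"
proof -
  have "v = 0" if "A *v v = 0" for v
    using assms(1) assms(2)[of v] that by (simp add: mult_le_0_iff)
  then show ?thesis
    by (simp add: invertible_left_inverse matrix_left_invertible_ker)
qed

text \<open>By Cauchy-Schwarz the quadratic form is at most \<open>norm u * norm (A *v u)\<close>,
  and one factor \<open>norm u\<close> cancels. This estimate turns a small right-hand side into a
  small solution.\<close>

lemma coercive_norm_le:
  fixes A :: "real ^ 'd ^ 'd"
  assumes "c > 0" "\<And>v. c * (norm v)\<^sup>2 \<le> v \<bullet> (A *v v)"
  shows "norm u \<le> norm (A *v u) / c"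
proof (cases "u = 0")
  case False
  have "c * (norm u)\<^sup>2 \<le> norm u * norm (A *v u)"
    using assms(2)[of u] norm_cauchy_schwarz[of u "A *v u"] by linarith
  then have "c * norm u \<le> norm (A *v u)"
    using False by (simp add: power2_eq_square)
  then show ?thesis
    using assms(1) by (simp add: field_simps)
qed (use assms(1) in simp)

text \<open>The double sum runs over all pairs of coordinates, and each term is at most
  \<open>e * (norm v)\<^sup>2\<close>. The crude factor is harmless because the dimension is
  fixed.\<close>

lemma abs_quadratic_form_le:
  fixes A :: "real ^ 'd ^ 'd"
  assumes "\<And>j k. \<bar>A $ j $ k\<bar> \<le> e"
  shows "\<bar>v \<bullet> (A *v v)\<bar> \<le> (real CARD('d))\<^sup>2 * e * (norm v)\<^sup>2"
proof -
  have "v \<bullet> (A *v v) = (\<Sum>j\<in>UNIV. \<Sum>k\<in>UNIV. v $ j * (A $ j $ k * v $ k))"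
    by (simp add: inner_vec_def matrix_vector_mult_def sum_distrib_left)
  also have "\<bar>\<dots>\<bar> \<le> (\<Sum>j\<in>UNIV. \<Sum>k\<in>UNIV. \<bar>v $ j * (A $ j $ k * v $ k)\<bar>)"
    by (rule order_trans[OF sum_abs sum_mono[OF sum_abs]])
  also have "\<dots> \<le> (\<Sum>j\<in>(UNIV :: 'd set). \<Sum>k\<in>(UNIV :: 'd set). norm v * (e * norm v))"
    unfolding abs_mult using assms
    by (intro sum_mono mult_mono component_le_norm_cart) (auto intro: order_trans[OF abs_ge_zero])
  also have "\<dots> = (real CARD('d))\<^sup>2 * e * (norm v)\<^sup>2"
    by (simp add: power2_eq_square)
  finally show ?thesis .
qed

text \<open>Write \<open>A\<close> as \<open>r *\<^sub>R S\<close> plus an error. The quadratic form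
  of the error costs at most half of the coercivity of the main part, and the other half remains.
  The scale \<open>r\<close> will be the sample size, with \<open>A\<close> an unnormalised Gram
  matrix.\<close>

lemma coercive_perturbation:
  fixes A S :: "real ^ 'd ^ 'd"
  assumes S: "\<And>v. c * (norm v)\<^sup>2 \<le> v \<bullet> (S *v v)"
    and A: "\<And>j k. \<bar>A $ j $ k - r * S $ j $ k\<bar> \<le> r * e"
    and e: "(real CARD('d))\<^sup>2 * e \<le> c / 2" and r: "r \<ge> 0"
  shows "r * (c / 2) * (norm v)\<^sup>2 \<le> v \<bullet> (A *v v)"
proof -
  have "\<bar>v \<bullet> ((A - r *\<^sub>R S) *v v)\<bar> \<le> (real CARD('d))\<^sup>2 * (r * e) * (norm v)\<^sup>2"
    by (rule abs_quadratic_form_le) (use A in simp)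
  also have "\<dots> = r * (norm v)\<^sup>2 * ((real CARD('d))\<^sup>2 * e)"
    by simp
  also have "\<dots> \<le> r * (norm v)\<^sup>2 * (c / 2)"
    using e r by (intro mult_left_mono) auto
  finally have "\<bar>v \<bullet> ((A - r *\<^sub>R S) *v v)\<bar> \<le> r * (norm v)\<^sup>2 * (c / 2)" .
  moreover have "v \<bullet> ((A - r *\<^sub>R S) *v v) = v \<bullet> (A *v v) - r * (v \<bullet> (S *v v))"
    by (simp add: matrix_vector_mult_diff_rdistrib inner_diff_right scaleR_matrix_vector_assoc[symmetric])
  moreover have "r * (c * (norm v)\<^sup>2) \<le> r * (v \<bullet> (S *v v))"
    using S r by (intro mult_left_mono) auto
  ultimately have "r * (c * (norm v)\<^sup>2) - r * (norm v)\<^sup>2 * (c / 2) \<le> v \<bullet> (A *v v)"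
    by linarith
  then show ?thesis by (simp add: algebra_simps)
qed

section \<open>Reduction of the estimating equation to a linear system\<close>

text \<open>Multiplying by the invertible Gram matrix clears the inverse in \<open>phi\<close> and
  leaves normal equations; the difference of their two sides is the sum of the rows weighted by the
  clipped residuals.\<close>

lemma phi_eq_0_iff:
  fixes x :: "nat \<Rightarrow> real ^ 'd"
  assumes inv: "invertible (gram n x)"
  shows "phi n l x y b = 0 \<longleftrightarrow>
    (\<Sum>i=1..n. (y i - x i \<bullet> b - mu_fun l x y b i) *\<^sub>R x i) = 0"
proof -
  define G T where "G = gram n x" and "T = transpose_mult n x (\<lambda>i. y i - mu_fun l x y b i)"
  \<comment> \<open>\<open>matrix_inv\<close> is a choice of two-sided inverse, so both identities
    follow from the existence of one.\<close>
  have inv': "G ** matrix_inv G = mat 1" "matrix_inv G ** G = mat 1"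
    using inv someI_ex[of "\<lambda>A'. G ** A' = mat 1 \<and> A' ** G = mat 1"]
    unfolding G_def invertible_def matrix_inv_def by blast+
  have "phi n l x y b = 0 \<longleftrightarrow> b = matrix_inv G *v T"
    by (simp add: phi_def G_def T_def)
  also have "\<dots> \<longleftrightarrow> G *v b = T"
    using inv' by (metis matrix_vector_mul_assoc matrix_vector_mul_lid)
  also have "\<dots> \<longleftrightarrow> T - G *v b = 0" by auto
  also have "T - G *v b = (\<Sum>i=1..n. (y i - x i \<bullet> b - mu_fun l x y b i) *\<^sub>R x i)"
    by (simp add: T_def G_def gram_eq_gram_on gram_on_mult_vec transpose_mult_eq_sum
        sum_subtractf[symmetric] algebra_simps)
  finally show ?thesis .
qed

text \<open>While the clipping pattern is fixed, this is the part of the clipped residual of row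
  \<open>i\<close> that does not depend on \<open>b\<close>: a clipped row keeps only the sign of
  its incidental parameter.\<close>

definition score_weight :: "nat \<Rightarrow> real \<Rightarrow> (nat \<Rightarrow> real) \<Rightarrow> (nat \<Rightarrow> real) \<Rightarrow> nat \<Rightarrow> real" where
  "score_weight s l m e i = (if i \<le> s then l * sgn (m i) else m i + e i)"

text \<open>The bound \<open>gk\<close> keeps the clipping pattern constant. With
  \<open>u = b - b0\<close>, a row past \<open>s\<close> has a residual of size at most
  \<open>2 * g + k * norm u\<close>, so it is not clipped. A row up to \<open>s\<close> starts from
  at least \<open>2 * l\<close> and is perturbed by at most \<open>g + k * norm u\<close>, hence by
  at most \<open>l\<close>, so it stays clipped with the sign of \<open>m i\<close>.\<close>

lemma phi_eq_0_iff_linear: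
  fixes x :: "nat \<Rightarrow> real ^ 'd"
  assumes inv: "invertible (gram n x)" and l: "l > 0" and s: "s \<le> n"
    and y: "\<And>i. i \<in> {1..n} \<Longrightarrow> y i = m i + x i \<bullet> b0 + e i"
    and x: "\<And>i. i \<in> {1..n} \<Longrightarrow> norm (x i) \<le> k"
    and e: "\<And>i. i \<in> {1..n} \<Longrightarrow> \<bar>e i\<bar> \<le> g"
    and large: "\<And>i. i \<in> {1..s} \<Longrightarrow> 2 * l \<le> \<bar>m i\<bar>"
    and small: "\<And>i. i \<in> {s<..n} \<Longrightarrow> \<bar>m i\<bar> \<le> g"
    and gk: "2 * g + k * norm (b - b0) \<le> l"
  shows "phi n l x y b = 0 \<longleftrightarrow>
    gram_on {s<..n} x *v (b - b0) = (\<Sum>i=1..n. score_weight s l m e i *\<^sub>R x i)"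
proof -
  define u where "u = b - b0"
  have psi: "y i - x i \<bullet> b - mu_fun l x y b i =
      score_weight s l m e i - (if i \<le> s then 0 else x i \<bullet> u)" if i: "i \<in> {1..n}" for i
  proof -
    define r where "r = y i - x i \<bullet> b"
    have r: "r = m i + e i - x i \<bullet> u"
      by (simp add: r_def u_def y[OF i] inner_diff_right)
    have "\<bar>x i \<bullet> u\<bar> \<le> norm (x i) * norm u" by (rule Cauchy_Schwarz_ineq2)
    also have "\<dots> \<le> k * norm u" using x[OF i] by (intro mult_right_mono) auto
    finally have xu: "\<bar>x i \<bullet> u\<bar> \<le> k * norm u" .
    have ei: "\<bar>e i\<bar> \<le> g" by (rule e[OF i])
    show ?thesis
    proof (cases "i \<le> s")
      case True
      then have "2 * l \<le> \<bar>m i\<bar>" using i large by auto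
      then have "\<bar>r\<bar> \<ge> l" "sgn r = sgn (m i)"
        using xu ei gk l unfolding r u_def[symmetric] by (auto simp: sgn_if)
      then show ?thesis
        using True l unfolding mu_fun_def r_def[symmetric] score_weight_def
        by (auto simp: sgn_if split: if_splits)
    next
      case False
      then have "\<bar>m i\<bar> \<le> g" using i small by auto
      then have "\<bar>r\<bar> \<le> l"
        using xu ei gk unfolding r u_def[symmetric] by linarith
      then have "mu_fun l x y b i = 0" by (simp add: mu_fun_def r_def)
      with False show ?thesis
        unfolding r_def[symmetric] score_weight_def by (simp add: r)
    qed
  qed
  have "(\<Sum>i=1..n. (y i - x i \<bullet> b - mu_fun l x y b i) *\<^sub>R x i) =
      (\<Sum>i=1..n. score_weight s l m e i *\<^sub>R x i - (if i \<le> s then 0 else x i \<bullet> u) *\<^sub>R x i)"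
    by (intro sum.cong refl) (simp only: psi scaleR_left_diff_distrib)
  also have "\<dots> = (\<Sum>i=1..n. score_weight s l m e i *\<^sub>R x i) - gram_on {s<..n} x *v u"
    unfolding sum_subtractf gram_on_mult_vec
    by (intro arg_cong2[where f = "(-)"] refl sum.mono_neutral_cong_right) auto
  finally show ?thesis
    unfolding phi_eq_0_iff[OF inv] u_def by auto
qed

section \<open>Independence of functions of the samples\<close>

lemma borel_measurable_vec_nth [measurable]:
  "(\<lambda>x :: real ^ 'd. x $ j) \<in> borel_measurable borel"
  by (intro borel_measurable_continuous_onI continuous_intros)

text \<open>Restricting the family to the disjoint blocks \<open>{i}\<close> and \<open>{k}\<close>
  gives two independent variables, and their measurable images inherit the independence.\<close>

lemma (in prob_space) indep_vars_mult:
  fixes X :: "'i \<Rightarrow> 'a \<Rightarrow> 'b :: topological_space" and f g :: "'b \<Rightarrow> real"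
  assumes ind: "indep_vars (\<lambda>_. borel) X I" and i: "i \<in> I" and k: "k \<in> I" and ne: "i \<noteq> k"
    and f: "f \<in> borel_measurable borel" and g: "g \<in> borel_measurable borel"
    and intf: "integrable M (\<lambda>\<omega>. f (X i \<omega>))" and intg: "integrable M (\<lambda>\<omega>. g (X k \<omega>))"
  shows "expectation (\<lambda>\<omega>. f (X i \<omega>) * g (X k \<omega>)) =
    expectation (\<lambda>\<omega>. f (X i \<omega>)) * expectation (\<lambda>\<omega>. g (X k \<omega>))"
proof -
  have "indep_var borel ((\<lambda>h. f (h i)) \<circ> (\<lambda>\<omega>. \<lambda>i\<in>{i}. X i \<omega>))
      borel ((\<lambda>h. g (h k)) \<circ> (\<lambda>\<omega>. \<lambda>i\<in>{k}. X i \<omega>))"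
    by (rule indep_var_compose[OF indep_var_restrict[OF ind]])
       (use i k ne f g in \<open>auto intro: measurable_compose[OF measurable_component_singleton]\<close>)
  then have "indep_var borel (\<lambda>\<omega>. f (X i \<omega>)) borel (\<lambda>\<omega>. g (X k \<omega>))"
    by (simp add: comp_def)
  then show ?thesis
    using intf intg by (rule indep_var_lebesgue_integral)
qed

text \<open>A measurable function of a family generates a sub-sigma-algebra of the one generated by
  the family, and independence passes to smaller collections of events. Functions of the whole
  family are allowed because the cross terms of the score involve two rows at once.\<close>

lemma (in prob_space) indep_set_sigma_generated:
  fixes X :: "'i \<Rightarrow> 'a \<Rightarrow> 'b :: topological_space" and Y :: "'j \<Rightarrow> 'a \<Rightarrow> 'c :: topological_space"
    and f :: "('i \<Rightarrow> 'b) \<Rightarrow> real" and g :: "('j \<Rightarrow> 'c) \<Rightarrow> real"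
  assumes ind: "indep_set (sigma_generated M I X) (sigma_generated M J Y)"
    and X: "\<And>i. i \<in> I \<Longrightarrow> X i \<in> borel_measurable M" and Y: "\<And>j. j \<in> J \<Longrightarrow> Y j \<in> borel_measurable M"
    and f: "f \<in> borel_measurable (\<Pi>\<^sub>M i\<in>I. borel)" and g: "g \<in> borel_measurable (\<Pi>\<^sub>M j\<in>J. borel)"
  shows "indep_var borel (\<lambda>\<omega>. f (\<lambda>i\<in>I. X i \<omega>)) borel (\<lambda>\<omega>. g (\<lambda>j\<in>J. Y j \<omega>))"
proof -
  have sub: "sigma_sets (space M) {(\<lambda>\<omega>. h (\<lambda>k\<in>K. Z k \<omega>)) -` A \<inter> space M | A. A \<in> sets borel}
      \<subseteq> sigma_generated M K Z"
    if h: "h \<in> borel_measurable (\<Pi>\<^sub>M k\<in>K. borel)"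
    for K :: "'k set" and Z :: "'k \<Rightarrow> 'a \<Rightarrow> 'd :: topological_space" and h :: "('k \<Rightarrow> 'd) \<Rightarrow> real"
  proof -
    have "(\<lambda>\<omega>. \<lambda>k\<in>K. Z k \<omega>) \<in> measurable (vimage_algebra (space M) (\<lambda>\<omega>. \<lambda>k\<in>K. Z k \<omega>)
        (\<Pi>\<^sub>M k\<in>K. borel)) (\<Pi>\<^sub>M k\<in>K. borel)"
      by (rule measurable_vimage_algebra1) (auto simp: space_PiM)
    from measurable_sets[OF measurable_compose[OF this h]]
    have "{(\<lambda>\<omega>. h (\<lambda>k\<in>K. Z k \<omega>)) -` A \<inter> space M | A. A \<in> sets borel} \<subseteq> sigma_generated M K Z"
      by (auto simp: sigma_generated_def)
    from sets.sigma_sets_subset[OF this[unfolded sigma_generated_def]]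
    show ?thesis by (simp add: sigma_generated_def)
  qed
  have meas: "(\<lambda>\<omega>. \<lambda>i\<in>I. X i \<omega>) \<in> measurable M (\<Pi>\<^sub>M i\<in>I. borel)"
    "(\<lambda>\<omega>. \<lambda>j\<in>J. Y j \<omega>) \<in> measurable M (\<Pi>\<^sub>M j\<in>J. borel)"
    using X Y by (auto intro!: measurable_restrict)
  show ?thesis
    unfolding indep_var_eq
  proof (intro conjI)
    show "random_variable borel (\<lambda>\<omega>. f (\<lambda>i\<in>I. X i \<omega>))"
      "random_variable borel (\<lambda>\<omega>. g (\<lambda>j\<in>J. Y j \<omega>))"
      using measurable_compose[OF meas(1) f] measurable_compose[OF meas(2) g] .
    show "indep_set (sigma_sets (space M) {(\<lambda>\<omega>. f (\<lambda>i\<in>I. X i \<omega>)) -` A \<inter> space M | A. A \<in> sets borel})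
      (sigma_sets (space M) {(\<lambda>\<omega>. g (\<lambda>j\<in>J. Y j \<omega>)) -` A \<inter> space M | A. A \<in> sets borel})"
      using ind sub[OF f, of X] sub[OF g, of Y] unfolding indep_sets2_eq by blast
  qed
qed

section \<open>Laws of large numbers for the Gram matrix and the score\<close>

context prob_space
begin

lemma
  fixes f :: "'b :: topological_space \<Rightarrow> real"
  assumes "X \<in> borel_measurable M" "X0 \<in> borel_measurable M"
    and "distr M borel X = distr M borel X0" and "f \<in> borel_measurable borel"
  shows expectation_eq_if_distr_eq: "expectation (\<lambda>\<omega>. f (X \<omega>)) = expectation (\<lambda>\<omega>. f (X0 \<omega>))"
    and integrable_iff_if_distr_eq: "integrable M (\<lambda>\<omega>. f (X \<omega>)) \<longleftrightarrow> integrable M (\<lambda>\<omega>. f (X0 \<omega>))"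
  using assms by (metis integral_distr, metis integrable_distr_eq)

text \<open>Truncation at \<open>kappa n\<close>, which is harmless by the hypothesis on the maximum, makes the
  summands square integrable with second moment at most \<open>(kappa n)\<^sup>2 * expectation (norm X0)\<^sup>2\<close>.\<close>

lemma second_moment_convergence:
  fixes X0 :: "'a \<Rightarrow> real ^ 'd" and X :: "nat \<Rightarrow> nat \<Rightarrow> 'a \<Rightarrow> real ^ 'd"
  assumes X0_meas [measurable]: "X0 \<in> borel_measurable M"
    and X0_sq: "integrable M (\<lambda>\<omega>. (norm (X0 \<omega>))\<^sup>2)"
    and X_indep: "\<And>n. indep_vars (\<lambda>_. borel) (X n) {1..n}"
    and X_distr: "\<And>n i. i \<in> {1..n} \<Longrightarrow> distr M borel (X n i) = distr M borel X0"
    and kappa_small: "kappa \<in> o(\<lambda>n. sqrt (real n))"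
    and max: "(\<lambda>n. prob {\<omega> \<in> space M. \<exists>i\<in>{1..n}. norm (X n i \<omega>) > kappa n}) \<longlonglongrightarrow> 0"
    and s_le: "\<And>n. s n \<le> n" and s_small: "(\<lambda>n. real (s n)) \<in> o(\<lambda>n. real n)" and e: "e > 0"
  shows "(\<lambda>n. prob {\<omega> \<in> space M. \<bar>(\<Sum>i\<in>{s n<..n}. X n i \<omega> $ j * X n i \<omega> $ k) -
      real n * expectation (\<lambda>\<omega>. X0 \<omega> $ j * X0 \<omega> $ k)\<bar> > real n * e}) \<longlonglongrightarrow> 0"
proof -
  define B S where "B = expectation (\<lambda>\<omega>. (norm (X0 \<omega>))\<^sup>2)"
    and "S = expectation (\<lambda>\<omega>. X0 \<omega> $ j * X0 \<omega> $ k)"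
  define f where "f n x = (if norm x \<le> kappa n then x $ j * x $ k else 0)" for n and x :: "real ^ 'd"
  define m where "m n = expectation (\<lambda>\<omega>. f n (X0 \<omega>))" for n
  define bad where "bad n = {\<omega> \<in> space M. \<exists>i\<in>{1..n}. norm (X n i \<omega>) > kappa n}" for n
  have X_meas: "X n i \<in> borel_measurable M" if "i \<in> {1..n}" for n i
    using X_indep that by (auto simp: indep_vars_def2)
  have f_meas [measurable]: "f n \<in> borel_measurable borel" for n
    unfolding f_def by measurable
  have prod_le: "\<bar>x $ j * x $ k\<bar> \<le> (norm x)\<^sup>2" for x :: "real ^ 'd"
    unfolding abs_mult power2_eq_square by (intro mult_mono component_le_norm_cart) auto
  have f_le: "\<bar>f n x\<bar> \<le> (norm x)\<^sup>2" for n x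
    using prod_le[of x] by (simp add: f_def)
  \<comment> \<open>Truncation trades one factor \<open>(norm x)\<^sup>2\<close> for
    \<open>(kappa n)\<^sup>2\<close>, so that the second moment of \<open>X0\<close> controls the
    square of a product, where a fourth moment would otherwise appear.\<close>
  have f_sq_le: "(f n x)\<^sup>2 \<le> (kappa n)\<^sup>2 * (norm x)\<^sup>2" for n x
  proof (cases "norm x \<le> kappa n")
    case True
    have "(f n x)\<^sup>2 = \<bar>f n x\<bar> * \<bar>f n x\<bar>" by (simp add: power2_eq_square)
    also have "\<dots> \<le> (norm x)\<^sup>2 * (norm x)\<^sup>2" by (intro mult_mono f_le) auto
    also have "\<dots> \<le> (kappa n)\<^sup>2 * (norm x)\<^sup>2"
      using True by (intro mult_right_mono power_mono) auto
    finally show ?thesis .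
  qed (simp add: f_def)
  have X0_jk: "integrable M (\<lambda>\<omega>. X0 \<omega> $ j * X0 \<omega> $ k)"
    by (rule Bochner_Integration.integrable_bound[OF X0_sq]) (use prod_le in auto)
  have f_int: "integrable M (\<lambda>\<omega>. f n (X0 \<omega>))" for n
    by (rule Bochner_Integration.integrable_bound[OF X0_sq]) (use f_le in auto)
  have f_sq_int: "integrable M (\<lambda>\<omega>. (f n (X0 \<omega>))\<^sup>2)" for n
    by (rule Bochner_Integration.integrable_bound[OF integrable_mult_right[OF X0_sq, of "(kappa n)\<^sup>2"]])
       (use f_sq_le in auto)
  have B0: "B \<ge> 0" unfolding B_def by simp
  have m_le: "\<bar>m n\<bar> \<le> B" for n
    unfolding m_def B_def
    by (rule order_trans[OF integral_abs_bound integral_mono[OF integrable_abs[OF f_int] X0_sq f_le]])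
  have bad_meas [measurable]: "bad n \<in> events" for n
  proof -
    have "bad n = (\<Union>i\<in>{1..n}. {\<omega> \<in> space M. norm (X n i \<omega>) > kappa n})"
      by (auto simp: bad_def)
    also have "\<dots> \<in> events"
      using X_meas by (intro sets.finite_UN) auto
    finally show ?thesis .
  qed
  \<comment> \<open>What truncation removes is an integral over the event that the norm of
    \<open>X0\<close> exceeds \<open>kappa n\<close>. Row 1 has the law of \<open>X0\<close>, so
    this event is no more likely than \<open>bad n\<close>; there has to be a row, hence
    \<open>n \<ge> 1\<close>.\<close>
  have m_lim: "m \<longlonglongrightarrow> S"
  proof -
    define A where "A n = {\<omega> \<in> space M. norm (X0 \<omega>) > kappa n}" for n
    have A_meas [measurable]: "A n \<in> events" for n unfolding A_def by measurable
    have "prob (A n) \<le> prob (bad n)" if "n \<ge> 1" for n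
    proof -
      have 1: "1 \<in> {1..n}" using that by auto
      note [measurable] = X_meas[OF 1] X_meas[OF 1, simplified]
      have "prob (A n) = measure (distr M borel X0) {x. norm x > kappa n}"
        by (subst measure_distr) (auto simp: A_def vimage_def Int_def conj_commute)
      also have "\<dots> = measure (distr M borel (X n 1)) {x. norm x > kappa n}"
        unfolding X_distr[OF 1] ..
      also have "\<dots> = prob {\<omega> \<in> space M. norm (X n 1 \<omega>) > kappa n}"
        by (subst measure_distr) (auto simp: vimage_def Int_def conj_commute)
      also have "\<dots> \<le> prob (bad n)"
        using 1 by (intro finite_measure_mono bad_meas) (auto simp: bad_def)
      finally show ?thesis .
    qed
    then have "eventually (\<lambda>n. prob (A n) \<le> prob (bad n)) sequentially"
      by (rule eventually_sequentiallyI)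
    then have "(\<lambda>n. prob (A n)) \<longlonglongrightarrow> 0"
      using max[folded bad_def] by (intro tendsto_sandwich[OF _ _ tendsto_const, of 0 "\<lambda>n. prob (A n)" _ "\<lambda>n. prob (bad n)"]) auto
    then have "(\<lambda>n. S - expectation (\<lambda>\<omega>. X0 \<omega> $ j * X0 \<omega> $ k * indicator (A n) \<omega>)) \<longlonglongrightarrow> S - 0"
      by (intro tendsto_diff tendsto_const integral_tendsto_0_if_measure_tendsto_0 X0_jk A_meas)
    moreover have "S - expectation (\<lambda>\<omega>. X0 \<omega> $ j * X0 \<omega> $ k * indicator (A n) \<omega>) = m n" for n
    proof -
      have "S - expectation (\<lambda>\<omega>. X0 \<omega> $ j * X0 \<omega> $ k * indicator (A n) \<omega>) =
          expectation (\<lambda>\<omega>. X0 \<omega> $ j * X0 \<omega> $ k - X0 \<omega> $ j * X0 \<omega> $ k * indicator (A n) \<omega>)"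
        unfolding S_def using X0_jk A_meas
        by (intro Bochner_Integration.integral_diff[symmetric] integrable_real_mult_indicator)
      also have "\<dots> = m n"
        unfolding m_def by (intro Bochner_Integration.integral_cong refl) (auto simp: f_def A_def indicator_def)
      finally show ?thesis .
    qed
    ultimately show ?thesis by simp
  qed
  define dev where "dev n = {\<omega> \<in> space M. \<bar>\<Sum>i\<in>{s n<..n}. f n (X n i \<omega>) - m n\<bar> > real n * (e / 2)}" for n
  have f_X: "expectation (\<lambda>\<omega>. f n (X n i \<omega>)) = m n" "integrable M (\<lambda>\<omega>. f n (X n i \<omega>))"
    "integrable M (\<lambda>\<omega>. (f n (X n i \<omega>))\<^sup>2)"
    "expectation (\<lambda>\<omega>. (f n (X n i \<omega>))\<^sup>2) \<le> (kappa n)\<^sup>2 * B" if i: "i \<in> {1..n}" for n i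
  proof -
    note eq = expectation_eq_if_distr_eq[OF X_meas[OF i] X0_meas X_distr[OF i]]
      and int = integrable_iff_if_distr_eq[OF X_meas[OF i] X0_meas X_distr[OF i]]
    show "expectation (\<lambda>\<omega>. f n (X n i \<omega>)) = m n" "integrable M (\<lambda>\<omega>. f n (X n i \<omega>))"
      by (auto simp: m_def eq int f_int)
    show "integrable M (\<lambda>\<omega>. (f n (X n i \<omega>))\<^sup>2)"
      by (subst int[of "\<lambda>x. (f n x)\<^sup>2"]) (auto simp: f_sq_int)
    have "expectation (\<lambda>\<omega>. (f n (X n i \<omega>))\<^sup>2) = expectation (\<lambda>\<omega>. (f n (X0 \<omega>))\<^sup>2)"
      by (rule eq) measurable
    also have "\<dots> \<le> expectation (\<lambda>\<omega>. (kappa n)\<^sup>2 * (norm (X0 \<omega>))\<^sup>2)"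
      by (intro integral_mono f_sq_int f_sq_le integrable_mult_right X0_sq)
    finally show "expectation (\<lambda>\<omega>. (f n (X n i \<omega>))\<^sup>2) \<le> (kappa n)\<^sup>2 * B"
      by (simp add: B_def)
  qed
  \<comment> \<open>Chebyshev's bound at the level \<open>real n * (e / 2)\<close>: halving the
    level produces the factor 4, and the bound vanishes because \<open>kappa\<close> is of smaller
    order than the square root of \<open>n\<close>.\<close>
  have dev_le: "prob (dev n) \<le> 4 * B / e\<^sup>2 * (kappa n / sqrt (real n))\<^sup>2" if n: "n \<ge> 1" for n
  proof -
    have "prob (dev n) \<le> real (card {s n<..n}) * ((kappa n)\<^sup>2 * B) / (real n * (e / 2))\<^sup>2"
      unfolding dev_def
    proof (rule prob_abs_sum_uncorrelated)
      fix i assume i: "i \<in> {s n<..n}"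
      then have i': "i \<in> {1..n}" by auto
      note [measurable] = X_meas[OF i'] and [simp] = f_X[OF i']
      have sq: "(f n (X n i \<omega>) - m n)\<^sup>2 = (f n (X n i \<omega>))\<^sup>2 + (m n)\<^sup>2 - 2 * m n * f n (X n i \<omega>)" for \<omega>
        by (simp add: power2_diff)
      show "(\<lambda>\<omega>. f n (X n i \<omega>) - m n) \<in> borel_measurable M" by measurable
      show "integrable M (\<lambda>\<omega>. (f n (X n i \<omega>) - m n)\<^sup>2)"
        unfolding sq by simp
      have "expectation (\<lambda>\<omega>. (f n (X n i \<omega>) - m n)\<^sup>2) = expectation (\<lambda>\<omega>. (f n (X n i \<omega>))\<^sup>2) - (m n)\<^sup>2"
        unfolding sq by (simp add: prob_space) (simp add: power2_eq_square)
      then show "expectation (\<lambda>\<omega>. (f n (X n i \<omega>) - m n)\<^sup>2) \<le> (kappa n)\<^sup>2 * B"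
        using f_X(4)[OF i'] zero_le_power2[of "m n"] by linarith
      fix l assume l: "l \<in> {s n<..n}" and "i \<noteq> l"
      then have l': "l \<in> {1..n}" by auto
      have "expectation (\<lambda>\<omega>. (f n (X n i \<omega>) - m n) * (f n (X n l \<omega>) - m n)) =
          expectation (\<lambda>\<omega>. f n (X n i \<omega>) - m n) * expectation (\<lambda>\<omega>. f n (X n l \<omega>) - m n)"
        using f_X[OF l'] \<open>i \<noteq> l\<close>
        by (intro indep_vars_mult[OF X_indep[of n] i' l', of "\<lambda>x. f n x - m n" "\<lambda>x. f n x - m n"]) auto
      then show "expectation (\<lambda>\<omega>. (f n (X n i \<omega>) - m n) * (f n (X n l \<omega>) - m n)) = 0"
        by (simp add: prob_space)
    qed (use e n in auto)
    also have "\<dots> \<le> real n * ((kappa n)\<^sup>2 * B) / (real n * (e / 2))\<^sup>2"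
      using B0 by (intro divide_right_mono mult_right_mono) auto
    also have "\<dots> = 4 * B / e\<^sup>2 * (kappa n / sqrt (real n))\<^sup>2"
      using n e by (simp add: power_divide field_simps) (simp add: power2_eq_square)
    finally show ?thesis .
  qed
  have dev_meas: "dev n \<in> events" for n
  proof -
    have "(\<lambda>\<omega>. \<Sum>i\<in>{s n<..n}. f n (X n i \<omega>) - m n) \<in> borel_measurable M"
      by (intro borel_measurable_sum borel_measurable_diff borel_measurable_const
          measurable_compose[OF X_meas f_meas]) auto
    then show ?thesis unfolding dev_def by measurable
  qed
  \<comment> \<open>The tolerance \<open>real n * e\<close> is divided: half for the centred
    truncated sum, a quarter for replacing \<open>m n\<close> by \<open>S\<close>, and a quarter for
    the \<open>s n\<close> missing rows.\<close>
  have ev: "eventually (\<lambda>n. prob {\<omega> \<in> space M. \<bar>(\<Sum>i\<in>{s n<..n}. X n i \<omega> $ j * X n i \<omega> $ k) -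
      real n * S\<bar> > real n * e} \<le> prob (bad n) + 4 * B / e\<^sup>2 * (kappa n / sqrt (real n))\<^sup>2) sequentially"
  proof -
    have "eventually (\<lambda>n. \<bar>m n - S\<bar> < e / 4) sequentially"
      using tendstoD[OF m_lim, of "e / 4"] e by (simp add: dist_real_def)
    \<comment> \<open>The constant makes \<open>s n\<close> times the bound \<open>B\<close> on the
      truncated mean at most \<open>real n * (e / 4)\<close>; the added 1 keeps the denominator
      positive when \<open>B = 0\<close>.\<close>
    moreover have "eventually (\<lambda>n. norm (real (s n)) \<le> e / (4 * (B + 1)) * norm (real n)) sequentially"
      using e B0 by (intro landau_o.smallD[OF s_small]) auto
    moreover have "eventually (\<lambda>n::nat. n \<ge> 1) sequentially" by (rule eventually_ge_at_top)
    ultimately show ?thesis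
    proof eventually_elim
      case (elim n)
      have "real (s n) * B \<le> e / (4 * (B + 1)) * real n * B"
        using elim B0 by (intro mult_right_mono) auto
      also have "\<dots> = real n * (e / 4) * (B / (B + 1))"
        using B0 by (simp add: field_simps)
      also have "\<dots> \<le> real n * (e / 4)"
        using B0 e by (intro mult_left_le) auto
      finally have sB: "real (s n) * B \<le> real n * (e / 4)" .
      have "prob {\<omega> \<in> space M. \<bar>(\<Sum>i\<in>{s n<..n}. X n i \<omega> $ j * X n i \<omega> $ k) - real n * S\<bar> > real n * e}
          \<le> prob (bad n \<union> dev n)"
      \<comment> \<open>Outside \<open>bad n\<close> truncation changes no summand, so a large
        deviation of the original sum must come from \<open>dev n\<close>.\<close>
      proof (rule finite_measure_mono[OF subsetI])
        fix \<omega>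
        assume *: "\<omega> \<in> {\<omega> \<in> space M. \<bar>(\<Sum>i\<in>{s n<..n}. X n i \<omega> $ j * X n i \<omega> $ k) - real n * S\<bar> > real n * e}"
        show "\<omega> \<in> bad n \<union> dev n"
        proof (rule ccontr)
          assume "\<omega> \<notin> bad n \<union> dev n"
          with * have nb: "\<And>i. i \<in> {1..n} \<Longrightarrow> norm (X n i \<omega>) \<le> kappa n"
            and nd: "\<bar>\<Sum>i\<in>{s n<..n}. f n (X n i \<omega>) - m n\<bar> \<le> real n * (e / 2)"
            by (auto simp: bad_def dev_def not_less)
          have "(\<Sum>i\<in>{s n<..n}. f n (X n i \<omega>) - m n) =
              (\<Sum>i\<in>{s n<..n}. X n i \<omega> $ j * X n i \<omega> $ k) - (real n - real (s n)) * m n"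
            using s_le[of n] nb by (simp add: sum_subtractf f_def of_nat_diff)
          then have "(\<Sum>i\<in>{s n<..n}. X n i \<omega> $ j * X n i \<omega> $ k) - real n * S =
              (\<Sum>i\<in>{s n<..n}. f n (X n i \<omega>) - m n) + real n * (m n - S) - real (s n) * m n"
            by (simp add: algebra_simps)
          moreover have "\<bar>real n * (m n - S)\<bar> \<le> real n * (e / 4)"
            unfolding abs_mult using elim by (intro mult_mono) auto
          moreover have "\<bar>real (s n) * m n\<bar> \<le> real (s n) * B"
            unfolding abs_mult using m_le by (intro mult_mono) auto
          ultimately have "\<bar>(\<Sum>i\<in>{s n<..n}. X n i \<omega> $ j * X n i \<omega> $ k) - real n * S\<bar>
              \<le> real n * (e / 2) + real n * (e / 4) + real n * (e / 4)"
            using nd sB by linarith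
          also have "\<dots> = real n * e" by (simp add: field_simps)
          finally show False using * by auto
        qed
      qed (use dev_meas in auto)
      also have "\<dots> \<le> prob (bad n) + prob (dev n)"
        by (rule measure_Un_le[OF bad_meas dev_meas])
      finally show ?case using dev_le[of n] elim by linarith
    qed
  qed
  have "(\<lambda>n. prob (bad n) + 4 * B / e\<^sup>2 * (kappa n / sqrt (real n))\<^sup>2) \<longlonglongrightarrow> 0 + 4 * B / e\<^sup>2 * 0\<^sup>2"
    using max[folded bad_def] smalloD_tendsto[OF kappa_small] by (intro tendsto_intros)
  then have "(\<lambda>n. prob (bad n) + 4 * B / e\<^sup>2 * (kappa n / sqrt (real n))\<^sup>2) \<longlonglongrightarrow> 0" by simp
  from tendsto_sandwich[OF always_eventually[OF allI[OF measure_nonneg]] ev tendsto_const this]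
  show ?thesis unfolding S_def .
qed

text \<open>The weights depend on the errors only, so the expectation of a cross term splits into a
  weight part and a design part, and the latter vanishes because distinct rows are independent with
  mean zero. The centring thus comes from the design, whatever the means of the weights. A summand
  has second moment of order \<open>(lam n)\<^sup>2 + 1\<close>, and Chebyshev's inequality divides
  this by \<open>n\<close>.\<close>

lemma score_convergence:
  fixes X0 :: "'a \<Rightarrow> real ^ 'd" and X :: "nat \<Rightarrow> nat \<Rightarrow> 'a \<Rightarrow> real ^ 'd"
    and eps0 :: "'a \<Rightarrow> real" and eps :: "nat \<Rightarrow> nat \<Rightarrow> 'a \<Rightarrow> real"
  assumes X0_meas [measurable]: "X0 \<in> borel_measurable M"
    and X0_sq: "integrable M (\<lambda>\<omega>. (norm (X0 \<omega>))\<^sup>2)" and X0_mean: "expectation X0 = 0"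
    and X_indep: "\<And>n. indep_vars (\<lambda>_. borel) (X n) {1..n}"
    and X_distr: "\<And>n i. i \<in> {1..n} \<Longrightarrow> distr M borel (X n i) = distr M borel X0"
    and eps0_meas [measurable]: "eps0 \<in> borel_measurable M"
    and eps0_sq: "integrable M (\<lambda>\<omega>. (eps0 \<omega>)\<^sup>2)"
    and eps_meas: "\<And>n i. i \<in> {1..n} \<Longrightarrow> eps n i \<in> borel_measurable M"
    and eps_distr: "\<And>n i. i \<in> {1..n} \<Longrightarrow> distr M borel (eps n i) = distr M borel eps0"
    and X_eps_indep: "\<And>n. indep_set (sigma_generated M {1..n} (X n)) (sigma_generated M {1..n} (eps n))"
    and h_meas [measurable]: "\<And>n i. h n i \<in> borel_measurable borel"
    and h_le: "\<And>n i t. i \<in> {1..n} \<Longrightarrow> \<bar>h n i t\<bar> \<le> lam n + \<bar>t\<bar>"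
    and lam_pos: "\<And>n. lam n > 0" and lam_small: "lam \<in> o(\<lambda>n. sqrt (real n))" and e: "e > 0"
  shows "(\<lambda>n. prob {\<omega> \<in> space M. \<bar>\<Sum>i=1..n. h n i (eps n i \<omega>) * X n i \<omega> $ j\<bar> > real n * e}) \<longlonglongrightarrow> 0"
proof -
  define B V where "B = expectation (\<lambda>\<omega>. (norm (X0 \<omega>))\<^sup>2)" and "V = expectation (\<lambda>\<omega>. (eps0 \<omega>)\<^sup>2)"
  have B0: "B \<ge> 0" and V0: "V \<ge> 0" unfolding B_def V_def by simp_all
  have X_meas: "X n i \<in> borel_measurable M" if "i \<in> {1..n}" for n i
    using X_indep that by (auto simp: indep_vars_def2)
  have comp_le: "(x $ j)\<^sup>2 \<le> (norm x)\<^sup>2" for x :: "real ^ 'd"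
    using component_le_norm_cart[of x j] by (simp add: abs_le_square_iff[symmetric])
  have X0_j_sq: "integrable M (\<lambda>\<omega>. (X0 \<omega> $ j)\<^sup>2)"
    by (rule Bochner_Integration.integrable_bound[OF X0_sq]) (use comp_le in auto)
  have X0_int: "integrable M X0"
    using square_integrable_imp_integrable[of "\<lambda>\<omega>. norm (X0 \<omega>)"] X0_sq
    by (simp add: integrable_norm_iff)
  have X0_j_int: "integrable M (\<lambda>\<omega>. X0 \<omega> $ j)"
    using integrable_inner_left[of "axis j 1" M X0] X0_int by (simp add: inner_axis)
  have X0_j_mean: "expectation (\<lambda>\<omega>. X0 \<omega> $ j) = 0"
    using integral_inner_left[of "axis j 1" M X0] X0_int X0_mean by (simp add: inner_axis)
  have h_sq_le: "(h n i t)\<^sup>2 \<le> 2 * (lam n)\<^sup>2 + 2 * t\<^sup>2" if i: "i \<in> {1..n}" for n i t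
  proof -
    have "(h n i t)\<^sup>2 \<le> (lam n + \<bar>t\<bar>)\<^sup>2"
      using h_le[OF i, of t] lam_pos[of n] by (simp add: abs_le_square_iff[symmetric])
    also have "\<dots> \<le> 2 * (lam n)\<^sup>2 + 2 * t\<^sup>2"
      using sum_squares_bound[of "lam n" "\<bar>t\<bar>"] by (simp add: power2_sum)
    finally show ?thesis .
  qed
  have bound: "prob {\<omega> \<in> space M. \<bar>\<Sum>i=1..n. h n i (eps n i \<omega>) * X n i \<omega> $ j\<bar> > real n * e}
      \<le> 2 * B / e\<^sup>2 * ((lam n / sqrt (real n))\<^sup>2 + V / real n)" if n: "n \<ge> 1" for n
  proof -
    have h_sq_int: "integrable M (\<lambda>\<omega>. (h n i (eps n i \<omega>))\<^sup>2)"
      and h_sq_E: "expectation (\<lambda>\<omega>. (h n i (eps n i \<omega>))\<^sup>2) \<le> 2 * (lam n)\<^sup>2 + 2 * V"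
      if i: "i \<in> {1..n}" for i
    proof -
      note [measurable] = eps_meas[OF i]
      have int: "integrable M (\<lambda>\<omega>. (eps n i \<omega>)\<^sup>2)"
        by (subst integrable_iff_if_distr_eq[OF eps_meas[OF i] eps0_meas eps_distr[OF i], of "\<lambda>t. t\<^sup>2"])
           (auto simp: eps0_sq)
      then have int2: "integrable M (\<lambda>\<omega>. 2 * (lam n)\<^sup>2 + 2 * (eps n i \<omega>)\<^sup>2)" by simp
      show int3: "integrable M (\<lambda>\<omega>. (h n i (eps n i \<omega>))\<^sup>2)"
        by (rule Bochner_Integration.integrable_bound[OF int2]) (use h_sq_le[OF i] in auto)
      have "expectation (\<lambda>\<omega>. (h n i (eps n i \<omega>))\<^sup>2) \<le> expectation (\<lambda>\<omega>. 2 * (lam n)\<^sup>2 + 2 * (eps n i \<omega>)\<^sup>2)"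
        by (intro integral_mono int2 int3 h_sq_le[OF i])
      also have "\<dots> = 2 * (lam n)\<^sup>2 + 2 * expectation (\<lambda>\<omega>. (eps n i \<omega>)\<^sup>2)"
        using int by (simp add: prob_space)
      also have "expectation (\<lambda>\<omega>. (eps n i \<omega>)\<^sup>2) = V"
        unfolding V_def
        by (rule expectation_eq_if_distr_eq[OF eps_meas[OF i] eps0_meas eps_distr[OF i]]) measurable
      finally show "expectation (\<lambda>\<omega>. (h n i (eps n i \<omega>))\<^sup>2) \<le> 2 * (lam n)\<^sup>2 + 2 * V" .
    qed
    have X_sq_int: "integrable M (\<lambda>\<omega>. (X n i \<omega> $ j)\<^sup>2)"
      and X_sq_E: "expectation (\<lambda>\<omega>. (X n i \<omega> $ j)\<^sup>2) \<le> B"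
      and X_int: "integrable M (\<lambda>\<omega>. X n i \<omega> $ j)"
      and X_E: "expectation (\<lambda>\<omega>. X n i \<omega> $ j) = 0" if i: "i \<in> {1..n}" for i
    proof -
      note eq = expectation_eq_if_distr_eq[OF X_meas[OF i] X0_meas X_distr[OF i]]
        and int = integrable_iff_if_distr_eq[OF X_meas[OF i] X0_meas X_distr[OF i]]
      show "integrable M (\<lambda>\<omega>. (X n i \<omega> $ j)\<^sup>2)"
        by (subst int[of "\<lambda>x. (x $ j)\<^sup>2"]) (auto simp: X0_j_sq)
      show "integrable M (\<lambda>\<omega>. X n i \<omega> $ j)"
        by (subst int[of "\<lambda>x. x $ j"]) (auto simp: X0_j_int)
      show "expectation (\<lambda>\<omega>. X n i \<omega> $ j) = 0"
        by (subst eq[of "\<lambda>x. x $ j"]) (auto simp: X0_j_mean)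
      have "expectation (\<lambda>\<omega>. (X n i \<omega> $ j)\<^sup>2) = expectation (\<lambda>\<omega>. (X0 \<omega> $ j)\<^sup>2)"
        by (rule eq) measurable
      also have "\<dots> \<le> B"
        unfolding B_def by (intro integral_mono X0_j_sq X0_sq comp_le)
      finally show "expectation (\<lambda>\<omega>. (X n i \<omega> $ j)\<^sup>2) \<le> B" .
    qed
    \<comment> \<open>With \<open>i = k\<close> this factors the second moments, with different
      indices the cross terms.\<close>
    have indep: "indep_var borel (\<lambda>\<omega>. X n i \<omega> $ j * X n k \<omega> $ j)
        borel (\<lambda>\<omega>. h n i (eps n i \<omega>) * h n k (eps n k \<omega>))"
      if i: "i \<in> {1..n}" and k: "k \<in> {1..n}" for i k
    proof -
      have X_proj: "(\<lambda>u. u l) \<in> measurable (\<Pi>\<^sub>M i\<in>{1..n}. (borel :: (real ^ 'd) measure)) borel"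
        and eps_proj: "(\<lambda>u. u l) \<in> measurable (\<Pi>\<^sub>M i\<in>{1..n}. (borel :: real measure)) borel"
        if "l \<in> {1..n}" for l
        using that by (rule measurable_component_singleton)+
      have f: "(\<lambda>u. u i $ j * u k $ j) \<in> borel_measurable (\<Pi>\<^sub>M i\<in>{1..n}. (borel :: (real ^ 'd) measure))"
        by (intro borel_measurable_times
            measurable_compose[OF X_proj borel_measurable_vec_nth] i k)
      have g: "(\<lambda>u. h n i (u i) * h n k (u k)) \<in> borel_measurable (\<Pi>\<^sub>M i\<in>{1..n}. (borel :: real measure))"
        by (intro borel_measurable_times measurable_compose[OF eps_proj h_meas] i k)
      from indep_set_sigma_generated[OF X_eps_indep[of n] X_meas eps_meas f g] show ?thesis
        using i k by simp
    qed
    have "prob {\<omega> \<in> space M. \<bar>\<Sum>i\<in>{1..n}. h n i (eps n i \<omega>) * X n i \<omega> $ j\<bar> > real n * e}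
      \<le> real (card {1..n}) * (B * (2 * (lam n)\<^sup>2 + 2 * V)) / (real n * e)\<^sup>2"
    proof (rule prob_abs_sum_uncorrelated)
      fix i assume i: "i \<in> {1..n}"
      note [measurable] = eps_meas[OF i] X_meas[OF i]
      have sq: "(h n i (eps n i \<omega>) * X n i \<omega> $ j)\<^sup>2 = (X n i \<omega> $ j)\<^sup>2 * (h n i (eps n i \<omega>))\<^sup>2" for \<omega>
        by (simp add: power_mult_distrib mult.commute)
      note ind = indep[OF i i, folded power2_eq_square]
      show "(\<lambda>\<omega>. h n i (eps n i \<omega>) * X n i \<omega> $ j) \<in> borel_measurable M" by measurable
      show "integrable M (\<lambda>\<omega>. (h n i (eps n i \<omega>) * X n i \<omega> $ j)\<^sup>2)"
        unfolding sq by (rule indep_var_integrable[OF ind X_sq_int[OF i] h_sq_int[OF i]])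
      show "expectation (\<lambda>\<omega>. (h n i (eps n i \<omega>) * X n i \<omega> $ j)\<^sup>2) \<le> B * (2 * (lam n)\<^sup>2 + 2 * V)"
        unfolding sq indep_var_lebesgue_integral[OF ind X_sq_int[OF i] h_sq_int[OF i]]
        by (intro mult_mono h_sq_E[OF i] X_sq_E[OF i] B0) simp
      fix k assume k: "k \<in> {1..n}" and ne: "i \<noteq> k"
      note [measurable] = eps_meas[OF k] X_meas[OF k]
      have int: "integrable M (\<lambda>\<omega>. X n i \<omega> $ j * X n k \<omega> $ j)"
        "integrable M (\<lambda>\<omega>. h n i (eps n i \<omega>) * h n k (eps n k \<omega>))"
        by (intro integrable_mult_if_squares h_sq_int X_sq_int i k; measurable)+
      have "expectation (\<lambda>\<omega>. X n i \<omega> $ j * X n k \<omega> $ j) =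
          expectation (\<lambda>\<omega>. X n i \<omega> $ j) * expectation (\<lambda>\<omega>. X n k \<omega> $ j)"
        by (rule indep_vars_mult[OF X_indep i k ne, where f = "\<lambda>x. x $ j" and g = "\<lambda>x. x $ j"])
           (rule borel_measurable_vec_nth X_int[OF i] X_int[OF k])+
      then have "expectation (\<lambda>\<omega>. (X n i \<omega> $ j * X n k \<omega> $ j) * (h n i (eps n i \<omega>) * h n k (eps n k \<omega>))) = 0"
        unfolding indep_var_lebesgue_integral[OF indep[OF i k] int] by (simp only: X_E i mult_zero_left)
      then show "expectation (\<lambda>\<omega>. h n i (eps n i \<omega>) * X n i \<omega> $ j * (h n k (eps n k \<omega>) * X n k \<omega> $ j)) = 0"
        by (simp only: mult_ac)
    qed (use e n in auto)
    also have "\<dots> = 2 * B / e\<^sup>2 * ((lam n / sqrt (real n))\<^sup>2 + V / real n)"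
      using n e by (simp add: power_divide field_simps) (simp add: power2_eq_square)
    finally show ?thesis .
  qed
  have "(\<lambda>n. 2 * B / e\<^sup>2 * ((lam n / sqrt (real n))\<^sup>2 + V / real n)) \<longlonglongrightarrow> 2 * B / e\<^sup>2 * (0\<^sup>2 + 0)"
    using smalloD_tendsto[OF lam_small] lim_const_over_n[of V] by (intro tendsto_intros)
  then have "(\<lambda>n. 2 * B / e\<^sup>2 * ((lam n / sqrt (real n))\<^sup>2 + V / real n)) \<longlonglongrightarrow> 0" by simp
  from tendsto_sandwich[OF always_eventually[OF allI[OF measure_nonneg]]
      eventually_sequentiallyI[OF bound] tendsto_const this]
  show ?thesis .
qed

end

section \<open>Measurable solutions of linear systems and conversions of the limit
  hypotheses\<close>

lemma borel_measurable_vecI: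
  fixes f :: "'a \<Rightarrow> real ^ 'd"
  assumes "\<And>j. (\<lambda>\<omega>. f \<omega> $ j) \<in> borel_measurable M"
  shows "f \<in> borel_measurable M"
  using assms by (subst borel_measurable_euclidean_space) (auto simp: Basis_vec_def inner_axis)

lemma borel_measurable_det:
  fixes A :: "'a \<Rightarrow> real ^ 'd ^ 'd"
  assumes "\<And>i j. (\<lambda>\<omega>. A \<omega> $ i $ j) \<in> borel_measurable M"
  shows "(\<lambda>\<omega>. det (A \<omega>)) \<in> borel_measurable M"
  unfolding det_def
  by (intro borel_measurable_sum borel_measurable_times borel_measurable_prod
      borel_measurable_const assms)

text \<open>Cramer's formula is chosen for measurability: determinants are polynomials in the
  entries. Division by zero makes the vector 0 for a singular matrix, so the formula is
  total.\<close>

definition cramer_solution :: "real ^ 'd ^ 'd \<Rightarrow> real ^ 'd \<Rightarrow> real ^ 'd" where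
  "cramer_solution A b = (\<chi> k. det (\<chi> i j. if j = k then b $ i else A $ i $ j) / det A)"

lemma borel_measurable_cramer_solution:
  fixes A :: "'a \<Rightarrow> real ^ 'd ^ 'd"
  assumes A: "\<And>i j. (\<lambda>\<omega>. A \<omega> $ i $ j) \<in> borel_measurable M"
    and b: "\<And>i. (\<lambda>\<omega>. b \<omega> $ i) \<in> borel_measurable M"
  shows "(\<lambda>\<omega>. cramer_solution (A \<omega>) (b \<omega>)) \<in> borel_measurable M"
proof (rule borel_measurable_vecI)
  fix k
  have "(\<lambda>\<omega>. if j = k then b \<omega> $ i else A \<omega> $ i $ j) \<in> borel_measurable M" for i j
    using A b by (cases "j = k") auto
  then show "(\<lambda>\<omega>. cramer_solution (A \<omega>) (b \<omega>) $ k) \<in> borel_measurable M"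
    unfolding cramer_solution_def vec_lambda_beta
    by (intro borel_measurable_divide borel_measurable_det A) (simp only: vec_lambda_beta)
qed

lemma norm_le_card_mult:
  fixes v :: "real ^ 'd"
  assumes "\<And>j. \<bar>v $ j\<bar> \<le> e"
  shows "norm v \<le> real CARD('d) * e"
  using order_trans[OF norm_le_l1_cart sum_bounded_above[of UNIV "\<lambda>j. \<bar>v $ j\<bar>" e]] assms by simp

text \<open>A zero denominator would make the quotient infinite, and the bounds on \<open>q\<close>
  exclude infinite values, so \<open>q\<close> is a positive real and the quotient can be cleared.
  This reads off real bounds on \<open>lam n\<close> from an extended-real limit, with
  \<open>x\<close> the square root of \<open>n\<close> or the size of a large incidental
  parameter.\<close>

lemma ereal_divide_less_imp_le:
  fixes q :: ereal
  assumes "ereal l / q < ereal c" "q \<ge> 0" "q \<le> ereal x" "l > 0" "c > 0"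
  shows "l \<le> c * x"
proof (cases q)
  case (real r)
  have "r \<noteq> 0"
  proof
    assume "r = 0"
    with real assms show False by (simp add: divide_ereal_def zero_ereal_def[symmetric])
  qed
  with real assms have r: "r > 0" "r \<le> x" by auto
  with real assms have "l / r < c" by simp
  with r have "l \<le> c * r" by (simp add: field_simps)
  also have "\<dots> \<le> c * x" using r assms by simp
  finally show ?thesis .
qed (use assms in auto)

text \<open>The maximum over an empty set has no usable value, so the two events are compared only
  from \<open>n = 1\<close> on, which does not affect the limit.\<close>

lemma tendsto_0_prob_Max:
  fixes f :: "nat \<Rightarrow> nat \<Rightarrow> 'a \<Rightarrow> real"
  assumes "(\<lambda>n. measure M {\<omega> \<in> space M. (MAX i\<in>{1..n}. f n i \<omega>) > k n}) \<longlonglongrightarrow> 0"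
  shows "(\<lambda>n. measure M {\<omega> \<in> space M. \<exists>i\<in>{1..n}. f n i \<omega> > k n}) \<longlonglongrightarrow> 0"
proof (rule Lim_transform_eventually[OF assms])
  have "{\<omega> \<in> space M. (MAX i\<in>{1..n}. f n i \<omega>) > k n} = {\<omega> \<in> space M. \<exists>i\<in>{1..n}. f n i \<omega> > k n}"
    if "n \<ge> 1" for n
    using that by (subst Max_gr_iff) auto
  then show "\<forall>\<^sub>F n in sequentially. measure M {\<omega> \<in> space M. (MAX i\<in>{1..n}. f n i \<omega>) > k n} =
      measure M {\<omega> \<in> space M. \<exists>i\<in>{1..n}. f n i \<omega> > k n}"
    by (intro eventually_sequentiallyI[of 1]) simp
qed

section \<open>Existence, uniqueness and consistency of the root\<close>

theorem theorem3p2: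
  fixes M :: "'a measure"
    and X0 :: "'a \<Rightarrow> real ^ 'd" and eps0 :: "'a \<Rightarrow> real"
    and X :: "nat \<Rightarrow> nat \<Rightarrow> 'a \<Rightarrow> real ^ 'd"
    and eps Y :: "nat \<Rightarrow> nat \<Rightarrow> 'a \<Rightarrow> real"
    and beta_star :: "real ^ 'd" and mu :: "nat \<Rightarrow> nat \<Rightarrow> real"
    and sigma alpha :: real
    and kappa gamma lam :: "nat \<Rightarrow> real"
    and s1 s2 :: "nat \<Rightarrow> nat"
  assumes prob_space: "prob_space M"
    (* model *)
    and Y: "\<And>n i \<omega>. i \<in> {1..n} \<Longrightarrow> \<omega> \<in> space M \<Longrightarrow>
              Y n i \<omega> = mu n i + X n i \<omega> \<bullet> beta_star + eps n i \<omega>"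
    and X0_meas: "X0 \<in> borel_measurable M"
    and X0_sq: "integrable M (\<lambda>\<omega>. (norm (X0 \<omega>))\<^sup>2)"
    and X0_mean: "(\<integral>\<omega>. X0 \<omega> \<partial>M) = 0"
    and X0_cov: "positive_definite (covariance_matrix M X0)"
    and eps0_meas: "eps0 \<in> borel_measurable M"
    and eps0_sq: "integrable M (\<lambda>\<omega>. (eps0 \<omega>)\<^sup>2)"
    and eps0_mean: "(\<integral>\<omega>. eps0 \<omega> \<partial>M) = 0"
    and sigma_pos: "sigma\<^sup>2 > 0"
    and eps0_var: "prob_space.variance M eps0 = sigma\<^sup>2"
    and X_indep: "\<And>n. prob_space.indep_vars M (\<lambda>_. borel) (X n) {1..n}"
    and X_distr: "\<And>n i. i \<in> {1..n} \<Longrightarrow> distr M borel (X n i) = distr M borel X0"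
    and eps_indep: "\<And>n. prob_space.indep_vars M (\<lambda>_. borel) (eps n) {1..n}"
    and eps_distr: "\<And>n i. i \<in> {1..n} \<Longrightarrow> distr M borel (eps n i) = distr M borel eps0"
    and X_eps_indep: "\<And>n. prob_space.indep_set M
              (sigma_generated M {1..n} (X n)) (sigma_generated M {1..n} (eps n))"
    (* Assumption (A) *)
    and kappa_pos: "\<And>n. kappa n > 0" and gamma_pos: "\<And>n. gamma n > 0"
    and kappa_small: "kappa \<in> o(\<lambda>n. sqrt (real n))"
    and gamma_small: "gamma \<in> o(\<lambda>n. sqrt (real n))"
    and kappa_max: "(\<lambda>n. measure M {\<omega> \<in> space M. (MAX i\<in>{1..n}. norm (X n i \<omega>)) > kappa n})
              \<longlonglongrightarrow> 0"
    and gamma_max: "(\<lambda>n. measure M {\<omega> \<in> space M. (MAX i\<in>{1..n}. \<bar>eps n i \<omega>\<bar>) > gamma n})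
              \<longlonglongrightarrow> 0"
    (* incidental parameters *)
    and s_le: "\<And>n. s1 n + s2 n \<le> n"
    and s_small: "(\<lambda>n. real (s1 n + s2 n)) \<in> o(\<lambda>n. real n)"
    and mu_large: "\<And>c. c > 0 \<Longrightarrow> eventually (\<lambda>n. \<forall>i\<in>{1..s1 n}.
              max (kappa n) (gamma n) \<le> c * \<bar>mu n i\<bar>) sequentially"
    and mu_mid: "\<And>n i. i \<in> {s1 n + 1..s1 n + s2 n} \<Longrightarrow>
              0 < \<bar>mu n i\<bar> \<and> \<bar>mu n i\<bar> \<le> gamma n"
    and mu_zero: "\<And>n i. i \<in> {s1 n + s2 n + 1..n} \<Longrightarrow> mu n i = 0"
    (* Assumption (B) *)
    and lam_pos: "\<And>n. lam n > 0"
    and kappa_lam: "kappa \<in> o(lam)"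
    and alpha: "alpha > 2"
    and gamma_lam: "\<And>n. alpha * gamma n \<le> lam n"
    and lam_small: "(\<lambda>n. ereal (lam n) / min (mu_min (s1 n) (mu n)) (ereal (sqrt (real n))))
              \<longlonglongrightarrow> 0"
    (* condition on s2, or Assumption (C) *)
    and s2_or_C: "(\<lambda>n. real (s2 n)) \<in> o(\<lambda>n. real n / (kappa n * gamma n)) \<or>
              (\<exists>\<delta>>0. integrable M (\<lambda>\<omega>. norm (X0 \<omega>) powr (2 + \<delta>)) \<and>
                 filterlim (\<lambda>n. lp_norm_on 2 {s1 n + 1..s1 n + s2 n} (mu n) /
                                lp_norm_on (2 + \<delta>) {s1 n + 1..s1 n + s2 n} (mu n))
                   at_top sequentially)"
  shows "\<forall>C>0. \<exists>(A :: nat \<Rightarrow> 'a set) (beta_hat :: nat \<Rightarrow> 'a \<Rightarrow> real ^ 'd).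
           (\<forall>n. A n \<in> sets M) \<and> (\<lambda>n. measure M (A n)) \<longlonglongrightarrow> 1 \<and>
           (\<forall>n. beta_hat n \<in> borel_measurable M) \<and>
           (\<forall>n. \<forall>\<omega>\<in>A n.
              invertible (gram n (\<lambda>i. X n i \<omega>)) \<and>
              beta_hat n \<omega> \<in> coord_box C beta_star \<and>
              phi n (lam n) (\<lambda>i. X n i \<omega>) (\<lambda>i. Y n i \<omega>) (beta_hat n \<omega>) = 0 \<and>
              (\<forall>b \<in> coord_box C beta_star.
                 phi n (lam n) (\<lambda>i. X n i \<omega>) (\<lambda>i. Y n i \<omega>) b = 0 \<longrightarrow> b = beta_hat n \<omega>)) \<and>
           (\<forall>e>0. (\<lambda>n. measure M {\<omega> \<in> space M. dist (beta_hat n \<omega>) beta_star > e}) \<longlonglongrightarrow> 0)"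
proof (intro allI impI)
  fix C :: real assume C: "C > 0"
  interpret prob_space M by (rule prob_space)
  define d where "d = real CARD('d)"
  have d: "d > 0" by (simp add: d_def)
  define Sig where "Sig = covariance_matrix M X0"
  obtain c where c: "c > 0" and Sig_c: "\<And>v. c * (norm v)\<^sup>2 \<le> v \<bullet> (Sig *v v)"
    using positive_definite_lower_bound[OF X0_cov] unfolding Sig_def by blast
  have X0_int: "integrable M X0"
    using square_integrable_imp_integrable[of "\<lambda>\<omega>. norm (X0 \<omega>)"] X0_sq X0_meas
    by (simp add: integrable_norm_iff)
  have "expectation (\<lambda>\<omega>. X0 \<omega> $ j) = 0" for j
    using integral_inner_left[of "axis j 1" M X0] X0_int X0_mean by (simp add: inner_axis)
  then have Sig: "Sig $ j $ k = expectation (\<lambda>\<omega>. X0 \<omega> $ j * X0 \<omega> $ k)" for j k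
    by (simp add: Sig_def covariance_matrix_def)
  have X_meas: "X n i \<in> borel_measurable M" if "i \<in> {1..n}" for n i
    using X_indep that by (auto simp: indep_vars_def2)
  have eps_meas: "eps n i \<in> borel_measurable M" if "i \<in> {1..n}" for n i
    using eps_indep that by (auto simp: indep_vars_def2)
  have X_nth_meas: "(\<lambda>\<omega>. X n i \<omega> $ j) \<in> borel_measurable M" if "i \<in> {1..n}" for n i j
    by (rule measurable_compose[OF X_meas[OF that] borel_measurable_vec_nth])
  \<comment> \<open>Since \<open>alpha > 2\<close>, the factor \<open>2 / alpha\<close> is below 1,
    and a positive fraction \<open>1 - 2 / alpha\<close> of \<open>lam n\<close> is left for the
    design term.\<close>
  have two_gamma: "2 * gamma n \<le> 2 / alpha * lam n" for n
  proof -
    have "alpha * gamma n * (2 / alpha) \<le> lam n * (2 / alpha)"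
      using alpha by (intro mult_right_mono gamma_lam) auto
    then show ?thesis using alpha by (simp add: field_simps)
  qed
  have gamma_le: "gamma n \<le> lam n" for n
  proof -
    have "1 * gamma n \<le> alpha * gamma n"
      using alpha gamma_pos[of n] by (intro mult_right_mono) auto
    then show ?thesis using gamma_lam[of n] by simp
  qed
  have mu_small: "\<bar>mu n i\<bar> \<le> gamma n" if "i \<in> {s1 n<..n}" for n i
    using mu_mid[of i n] mu_zero[of i n] gamma_pos[of n] that
    by (cases "i \<le> s1 n + s2 n") auto
  \<comment> \<open>A bound on the quotient by the minimum yields a bound for each of its two
    arguments; the infimum in \<open>mu_min\<close> makes the second one uniform in
    \<open>i\<close>.\<close>
  have lam_le: "eventually (\<lambda>n. lam n \<le> a * sqrt (real n) \<and> (\<forall>i\<in>{1..s1 n}. lam n \<le> a * \<bar>mu n i\<bar>)) sequentially"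
    if a: "a > 0" for a
  proof -
    have "eventually (\<lambda>n. ereal (lam n) / min (mu_min (s1 n) (mu n)) (ereal (sqrt (real n))) < ereal a) sequentially"
      using a by (intro order_tendstoD(2)[OF lam_small]) simp
    then show ?thesis
    proof eventually_elim
      case (elim n)
      have "mu_min (s1 n) (mu n) \<ge> 0" by (auto simp: mu_min_def intro: INF_greatest)
      then have "min (mu_min (s1 n) (mu n)) (ereal (sqrt (real n))) \<ge> 0" by simp
      note * = ereal_divide_less_imp_le[OF elim this _ lam_pos a]
      have "mu_min (s1 n) (mu n) \<le> ereal \<bar>mu n i\<bar>" if "i \<in> {1..s1 n}" for i
        unfolding mu_min_def using that by (rule INF_lower)
      then show ?case
        by (auto intro!: * intro: min.coboundedI1)
    qed
  qed
  have lam_small': "lam \<in> o(\<lambda>n. sqrt (real n))"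
  proof (rule landau_o.smallI)
    fix a :: real assume "a > 0"
    from lam_le[OF this] show "eventually (\<lambda>n. norm (lam n) \<le> a * norm (sqrt (real n))) sequentially"
      by eventually_elim (use lam_pos in \<open>simp add: less_imp_le\<close>)
  qed
  have s1_small: "(\<lambda>n. real (s1 n)) \<in> o(\<lambda>n. real n)"
  proof (rule landau_o.smallI)
    fix a :: real assume "a > 0"
    from landau_o.smallD[OF s_small this]
    show "eventually (\<lambda>n. norm (real (s1 n)) \<le> a * norm (real n)) sequentially"
      by eventually_elim simp
  qed
  have s1_le: "s1 n \<le> n" for n using s_le[of n] by simp
  have "eventually (\<lambda>n. n \<ge> 1 \<and> (\<forall>i\<in>{1..s1 n}. 2 * lam n \<le> \<bar>mu n i\<bar>) \<and>
      2 * gamma n + kappa n * (d * C) \<le> lam n) sequentially"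
  proof -
    \<comment> \<open>On the box the norm of \<open>b - beta_star\<close> is at most
      \<open>d * C\<close>. The constant is chosen so that \<open>kappa n * (d * C)\<close> fits
      into the fraction of \<open>lam n\<close> left over by \<open>2 * gamma n\<close>.\<close>
    have "(1 - 2 / alpha) / (d * C) > 0" using alpha d C by simp
    from landau_o.smallD[OF kappa_lam this]
    have "eventually (\<lambda>n. norm (kappa n) \<le> (1 - 2 / alpha) / (d * C) * norm (lam n)) sequentially" .
    moreover have "eventually (\<lambda>n. lam n \<le> 1 / 2 * sqrt (real n) \<and>
        (\<forall>i\<in>{1..s1 n}. lam n \<le> 1 / 2 * \<bar>mu n i\<bar>)) sequentially"
      by (rule lam_le) simp
    moreover have "eventually (\<lambda>n::nat. n \<ge> 1) sequentially" by (rule eventually_ge_at_top)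
    ultimately show ?thesis
    proof eventually_elim
      case (elim n)
      have "kappa n * (d * C) \<le> (1 - 2 / alpha) / (d * C) * lam n * (d * C)"
        using elim(1) kappa_pos[of n] lam_pos[of n] d C by (intro mult_right_mono) auto
      also have "\<dots> = lam n - 2 / alpha * lam n"
      proof -
        have "x / y * l * y = x * l" if "y \<noteq> 0" for x y l :: real using that by simp
        from this[of "d * C" "1 - 2 / alpha" "lam n"] show ?thesis
          using d C by (simp add: left_diff_distrib)
      qed
      finally have "2 * gamma n + kappa n * (d * C) \<le> lam n"
        using two_gamma[of n] by linarith
      with elim show ?case by auto
    qed
  qed
  then obtain N where N: "\<And>n. n \<ge> N \<Longrightarrow> n \<ge> 1"
    "\<And>n i. n \<ge> N \<Longrightarrow> i \<in> {1..s1 n} \<Longrightarrow> 2 * lam n \<le> \<bar>mu n i\<bar>"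
    "\<And>n. n \<ge> N \<Longrightarrow> 2 * gamma n + kappa n * (d * C) \<le> lam n"
    unfolding eventually_sequentially by blast

  \<comment> \<open>Exceptional events and the estimator\<close>
  define Sn where "Sn n \<omega> = gram_on {s1 n<..n} (\<lambda>i. X n i \<omega>)" for n \<omega>
  define Vn where "Vn n \<omega> = (\<Sum>i=1..n. score_weight (s1 n) (lam n) (mu n) (\<lambda>i. eps n i \<omega>) i *\<^sub>R X n i \<omega>)" for n \<omega>
  define un where "un n \<omega> = cramer_solution (Sn n \<omega>) (Vn n \<omega>)" for n \<omega>
  \<comment> \<open>The constant \<open>eta\<close> satisfies
    \<open>d\<^sup>2 * eta = c / 2\<close>, as \<open>coercive_perturbation\<close> requires. The
    next one is fitted so that score entries of size at most \<open>real n * r e\<close> give a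
    solution of norm at most \<open>e\<close>, after a factor \<open>d\<close> for passing to the
    norm and a division by \<open>real n * (c / 2)\<close>.\<close>
  define eta where "eta = c / (2 * d\<^sup>2)"
  define r where "r e = c * e / (2 * d)" for e
  define BX where "BX n = {\<omega> \<in> space M. \<exists>i\<in>{1..n}. norm (X n i \<omega>) > kappa n}" for n
  define BE where "BE n = {\<omega> \<in> space M. \<exists>i\<in>{1..n}. \<bar>eps n i \<omega>\<bar> > gamma n}" for n
  define BS where "BS n j k = {\<omega> \<in> space M. \<bar>Sn n \<omega> $ j $ k - real n * Sig $ j $ k\<bar> > real n * eta}" for n j k
  define BV where "BV e n j = {\<omega> \<in> space M. \<bar>Vn n \<omega> $ j\<bar> > real n * r e}" for e n j
  have Sn_nth: "Sn n \<omega> $ j $ k = (\<Sum>i\<in>{s1 n<..n}. X n i \<omega> $ j * X n i \<omega> $ k)" for n \<omega> j k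
    by (simp add: Sn_def gram_on_def)
  \<comment> \<open>The weight of a row involves only the error of that row, so a constant error
    family expresses it as a function of one real variable, the form required by
    \<open>score_convergence\<close>.\<close>
  define h where "h n i t = score_weight (s1 n) (lam n) (mu n) (\<lambda>_. t) i" for n i t
  have Vn_nth: "Vn n \<omega> $ j = (\<Sum>i=1..n. h n i (eps n i \<omega>) * X n i \<omega> $ j)" for n \<omega> j
    by (simp add: Vn_def h_def score_weight_def)
  have h_meas: "h n i \<in> borel_measurable borel" for n i
    unfolding h_def score_weight_def by (cases "i \<le> s1 n") auto
  \<comment> \<open>Past \<open>s1 n\<close> the incidental parameters are bounded by
    \<open>gamma n\<close>, hence by \<open>lam n\<close>, so they add no more to the weight than
    clipping does in the other rows.\<close>
  have h_le: "\<bar>h n i t\<bar> \<le> lam n + \<bar>t\<bar>" if "i \<in> {1..n}" for n i t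
    using mu_small[of i n] gamma_le[of n] lam_pos[of n] that
    by (auto simp: h_def score_weight_def abs_mult sgn_if)
  have Sn_meas: "(\<lambda>\<omega>. Sn n \<omega> $ j $ k) \<in> borel_measurable M" for n j k
    unfolding Sn_nth by (intro borel_measurable_sum borel_measurable_times X_nth_meas) auto
  have Vn_meas: "(\<lambda>\<omega>. Vn n \<omega> $ j) \<in> borel_measurable M" for n j
    unfolding Vn_nth
    by (intro borel_measurable_sum borel_measurable_times X_nth_meas measurable_compose[OF eps_meas h_meas]) auto
  have un_meas: "un n \<in> borel_measurable M" for n
    unfolding un_def by (intro borel_measurable_cramer_solution Sn_meas Vn_meas)
  have BX_ev: "BX n \<in> events" and BE_ev: "BE n \<in> events" for n
  proof -
    have "BX n = (\<Union>i\<in>{1..n}. {\<omega> \<in> space M. norm (X n i \<omega>) > kappa n})"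
      "BE n = (\<Union>i\<in>{1..n}. {\<omega> \<in> space M. \<bar>eps n i \<omega>\<bar> > gamma n})"
      by (auto simp: BX_def BE_def)
    moreover have "{\<omega> \<in> space M. norm (X n i \<omega>) > kappa n} \<in> events"
      "{\<omega> \<in> space M. \<bar>eps n i \<omega>\<bar> > gamma n} \<in> events" if i: "i \<in> {1..n}" for i
    proof -
      note [measurable] = X_meas[OF i] eps_meas[OF i]
      show "{\<omega> \<in> space M. norm (X n i \<omega>) > kappa n} \<in> events"
        "{\<omega> \<in> space M. \<bar>eps n i \<omega>\<bar> > gamma n} \<in> events" by measurable
    qed
    ultimately show "BX n \<in> events" "BE n \<in> events" by (auto intro!: sets.finite_UN)
  qed
  have BS_ev: "BS n j k \<in> events" for n j k
  proof -
    note [measurable] = Sn_meas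
    show ?thesis unfolding BS_def by measurable
  qed
  have BV_ev: "BV e n j \<in> events" for e n j
  proof -
    note [measurable] = Vn_meas
    show ?thesis unfolding BV_def by measurable
  qed
  have BX_lim: "(\<lambda>n. prob (BX n)) \<longlonglongrightarrow> 0" and BE_lim: "(\<lambda>n. prob (BE n)) \<longlonglongrightarrow> 0"
    unfolding BX_def BE_def
    by (rule tendsto_0_prob_Max[OF kappa_max], rule tendsto_0_prob_Max[OF gamma_max])
  have BS_lim: "(\<lambda>n. prob (BS n j k)) \<longlonglongrightarrow> 0" for j k
    unfolding BS_def Sn_nth Sig
    by (rule second_moment_convergence[OF X0_meas X0_sq X_indep X_distr kappa_small
          BX_lim[unfolded BX_def] s1_le s1_small]) (use c d in \<open>simp_all add: eta_def\<close>)
  have BV_lim: "(\<lambda>n. prob (BV e n j)) \<longlonglongrightarrow> 0" if "e > 0" for e j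
    unfolding BV_def Vn_nth
    by (rule score_convergence[OF X0_meas X0_sq X0_mean X_indep X_distr eps0_meas eps0_sq eps_meas
          eps_distr X_eps_indep h_meas h_le lam_pos lam_small']) (use that c d in \<open>simp_all add: r_def\<close>)

  \<comment> \<open>The score enters at the level belonging to \<open>C\<close>, which puts the
    solution in the box. Consistency uses the level of each \<open>e\<close> separately.\<close>
  define bad where "bad n = BX n \<union> BE n \<union> (\<Union>(j, k)\<in>UNIV. BS n j k) \<union> (\<Union>j\<in>UNIV. BV C n j)" for n
  define A where "A n = (if n \<ge> N then space M - bad n else {})" for n
  define beta_hat where "beta_hat n \<omega> = (if \<omega> \<in> A n then beta_star + un n \<omega> else beta_star)" for n \<omega>
  have bad_ev: "bad n \<in> events" for n
    unfolding bad_def by (intro sets.Un sets.finite_UN BX_ev BE_ev) (auto simp: BS_ev BV_ev)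
  have A_ev: "A n \<in> events" for n using bad_ev by (auto simp: A_def)
  have bad_lim: "(\<lambda>n. prob (bad n)) \<longlonglongrightarrow> 0"
  proof -
    have le: "prob (bad n) \<le> prob (BX n) + prob (BE n) + (\<Sum>(j, k)\<in>UNIV. prob (BS n j k)) + (\<Sum>j\<in>UNIV. prob (BV C n j))" for n
    proof -
      have 1: "(\<Union>(j, k)\<in>UNIV. BS n j k) \<in> events" "(\<Union>j\<in>UNIV. BV C n j) \<in> events"
        by (intro sets.finite_UN; auto simp: BS_ev BV_ev)+
      have "prob (bad n) \<le> prob (BX n) + prob (BE n) + prob (\<Union>(j, k)\<in>UNIV. BS n j k) + prob (\<Union>j\<in>UNIV. BV C n j)"
        unfolding bad_def using BX_ev[of n] BE_ev[of n] 1
        by (meson add_mono measure_Un_le order_refl order_trans sets.Un)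
      moreover have "prob (\<Union>(j, k)\<in>UNIV. BS n j k) \<le> (\<Sum>p\<in>UNIV. prob (case p of (j, k) \<Rightarrow> BS n j k))"
        by (intro finite_measure_subadditive_finite) (auto simp: BS_ev)
      moreover have "prob (\<Union>j\<in>UNIV. BV C n j) \<le> (\<Sum>j\<in>UNIV. prob (BV C n j))"
        by (intro finite_measure_subadditive_finite) (auto simp: BV_ev)
      ultimately show ?thesis by (simp add: case_prod_unfold)
    qed
    have "(\<lambda>n. prob (BX n) + prob (BE n) + (\<Sum>(j, k)\<in>UNIV. prob (BS n j k)) + (\<Sum>j\<in>UNIV. prob (BV C n j)))
        \<longlonglongrightarrow> 0 + 0 + (\<Sum>(j, k)\<in>(UNIV :: ('d \<times> 'd) set). 0) + (\<Sum>j\<in>(UNIV :: 'd set). 0)"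
      unfolding case_prod_unfold
      by (intro tendsto_add tendsto_sum BX_lim BE_lim BS_lim BV_lim C)
    then have lim: "(\<lambda>n. prob (BX n) + prob (BE n) + (\<Sum>(j, k)\<in>UNIV. prob (BS n j k)) + (\<Sum>j\<in>UNIV. prob (BV C n j)))
        \<longlonglongrightarrow> 0" by simp
    show ?thesis
      by (rule tendsto_sandwich[OF always_eventually[OF allI[OF measure_nonneg]]
            always_eventually[OF allI[OF le]] tendsto_const lim])
  qed
  have A_lim: "(\<lambda>n. prob (A n)) \<longlonglongrightarrow> 1"
  proof (rule Lim_transform_eventually)
    show "(\<lambda>n. 1 - prob (bad n)) \<longlonglongrightarrow> 1"
      using tendsto_diff[OF tendsto_const[of 1] bad_lim] by simp
    show "\<forall>\<^sub>F n in sequentially. 1 - prob (bad n) = prob (A n)"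
      by (rule eventually_sequentiallyI[of N]) (simp add: A_def prob_compl[OF bad_ev])
  qed
  have beta_hat_meas: "beta_hat n \<in> borel_measurable M" for n
    unfolding beta_hat_def using A_ev un_meas by (intro measurable_If_set) auto

  \<comment> \<open>Solving the equation on the good events\<close>
  have A_D: "n \<ge> N" "\<omega> \<in> space M" "\<And>i. i \<in> {1..n} \<Longrightarrow> norm (X n i \<omega>) \<le> kappa n"
    "\<And>i. i \<in> {1..n} \<Longrightarrow> \<bar>eps n i \<omega>\<bar> \<le> gamma n"
    "\<And>j k. \<bar>Sn n \<omega> $ j $ k - real n * Sig $ j $ k\<bar> \<le> real n * eta"
    "\<And>j. \<bar>Vn n \<omega> $ j\<bar> \<le> real n * r C" if "\<omega> \<in> A n" for n \<omega>
    using that by (auto simp: A_def bad_def BX_def BE_def BS_def BV_def not_less split: if_splits)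
  have Sn_coercive: "real n * (c / 2) * (norm v)\<^sup>2 \<le> v \<bullet> (Sn n \<omega> *v v)" if "\<omega> \<in> A n" for n \<omega> v
    by (rule coercive_perturbation[OF Sig_c A_D(5)[OF that]])
       (use d in \<open>simp_all add: eta_def d_def[symmetric]\<close>)
  have n_c: "real n * (c / 2) > 0" if "\<omega> \<in> A n" for n \<omega>
    using N(1)[OF A_D(1)[OF that]] c by simp
  \<comment> \<open>The rows up to \<open>s1 n\<close> add squares to the quadratic form, so the
    full Gram matrix inherits the coercivity of \<open>Sn\<close>.\<close>
  have gram_inv: "invertible (gram n (\<lambda>i. X n i \<omega>))" if "\<omega> \<in> A n" for n \<omega>
  proof (rule coercive_invertible[OF n_c[OF that]])
    fix v
    have "v \<bullet> (Sn n \<omega> *v v) \<le> v \<bullet> (gram n (\<lambda>i. X n i \<omega>) *v v)"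
      unfolding Sn_def gram_eq_gram_on inner_gram_on by (intro sum_mono2) auto
    with Sn_coercive[OF that, of v]
    show "real n * (c / 2) * (norm v)\<^sup>2 \<le> v \<bullet> (gram n (\<lambda>i. X n i \<omega>) *v v)" by linarith
  qed
  have Sn_solve: "Sn n \<omega> *v u = Vn n \<omega> \<longleftrightarrow> u = un n \<omega>" if "\<omega> \<in> A n" for n \<omega> u
  proof -
    have "det (Sn n \<omega>) \<noteq> 0"
      using coercive_invertible[OF n_c[OF that] Sn_coercive[OF that]] by (simp add: invertible_det_nz)
    then show ?thesis unfolding un_def cramer_solution_def by (rule cramer)
  qed
  have un_le: "norm (un n \<omega>) \<le> e" if \<omega>: "\<omega> \<in> A n" and "\<And>j. \<bar>Vn n \<omega> $ j\<bar> \<le> real n * r e" for n \<omega> e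
  proof -
    have "norm (un n \<omega>) \<le> norm (Sn n \<omega> *v un n \<omega>) / (real n * (c / 2))"
      by (rule coercive_norm_le[OF n_c[OF \<omega>] Sn_coercive[OF \<omega>]])
    also have "Sn n \<omega> *v un n \<omega> = Vn n \<omega>" using Sn_solve[OF \<omega>] by blast
    also have "norm (Vn n \<omega>) / (real n * (c / 2)) \<le> d * (real n * r e) / (real n * (c / 2))"
      using norm_le_card_mult[OF that(2)] n_c[OF \<omega>] unfolding d_def
      by (intro divide_right_mono) auto
    also have "\<dots> = e" using N(1)[OF A_D(1)[OF \<omega>]] c d by (simp add: r_def field_simps)
    finally show ?thesis .
  qed
  have phi_iff: "phi n (lam n) (\<lambda>i. X n i \<omega>) (\<lambda>i. Y n i \<omega>) b = 0 \<longleftrightarrow> b = beta_hat n \<omega>"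
    if \<omega>: "\<omega> \<in> A n" and b: "b \<in> coord_box C beta_star" for n \<omega> b
  proof -
    note good = A_D[OF \<omega>]
    have "norm (b - beta_star) \<le> d * C"
      using b norm_le_card_mult[of "b - beta_star" C] by (simp add: coord_box_def d_def)
    then have "kappa n * norm (b - beta_star) \<le> kappa n * (d * C)"
      using kappa_pos[of n] by (intro mult_left_mono) auto
    then have gk: "2 * gamma n + kappa n * norm (b - beta_star) \<le> lam n"
      using N(3)[OF good(1)] by linarith
    have "phi n (lam n) (\<lambda>i. X n i \<omega>) (\<lambda>i. Y n i \<omega>) b = 0 \<longleftrightarrow> Sn n \<omega> *v (b - beta_star) = Vn n \<omega>"
      unfolding Sn_def Vn_def
      by (rule phi_eq_0_iff_linear[OF gram_inv[OF \<omega>] lam_pos s1_le Y[OF _ good(2)] good(3) good(4)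
            N(2)[OF good(1)] mu_small gk])
    also have "\<dots> \<longleftrightarrow> b = beta_hat n \<omega>"
      unfolding Sn_solve[OF \<omega>] using \<omega> by (auto simp: beta_hat_def diff_eq_eq add.commute)
    finally show ?thesis .
  qed
  have box: "beta_hat n \<omega> \<in> coord_box C beta_star" if \<omega>: "\<omega> \<in> A n" for n \<omega>
    using un_le[OF \<omega> A_D(6)[OF \<omega>]] \<omega>
    by (auto simp: coord_box_def beta_hat_def intro: order_trans[OF component_le_norm_cart])
  have consistent: "(\<lambda>n. prob {\<omega> \<in> space M. dist (beta_hat n \<omega>) beta_star > e}) \<longlonglongrightarrow> 0" if e: "e > 0" for e
  proof -
    have le: "prob {\<omega> \<in> space M. dist (beta_hat n \<omega>) beta_star > e} \<le> (\<Sum>j\<in>UNIV. prob (BV e n j))" for n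
    proof -
      \<comment> \<open>Off \<open>A n\<close> the distance is 0, so a distance above
        \<open>e\<close> occurs only on \<open>A n\<close>, and there \<open>un_le\<close> forces
        some entry of the score past its level.\<close>
      have "{\<omega> \<in> space M. dist (beta_hat n \<omega>) beta_star > e} \<subseteq> (\<Union>j\<in>UNIV. BV e n j)"
      proof
        fix \<omega> assume "\<omega> \<in> {\<omega> \<in> space M. dist (beta_hat n \<omega>) beta_star > e}"
        then have \<omega>: "\<omega> \<in> space M" "dist (beta_hat n \<omega>) beta_star > e" by auto
        with e have "\<omega> \<in> A n" "\<not> norm (un n \<omega>) \<le> e"
          by (auto simp: beta_hat_def dist_norm split: if_splits)
        with un_le[of \<omega> n e] obtain j where "\<not> \<bar>Vn n \<omega> $ j\<bar> \<le> real n * r e" by blast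
        with \<omega> show "\<omega> \<in> (\<Union>j\<in>UNIV. BV e n j)" by (auto simp: BV_def not_le)
      qed
      then have "prob {\<omega> \<in> space M. dist (beta_hat n \<omega>) beta_star > e} \<le> prob (\<Union>j\<in>UNIV. BV e n j)"
        by (intro finite_measure_mono sets.finite_UN) (auto simp: BV_ev)
      also have "\<dots> \<le> (\<Sum>j\<in>UNIV. prob (BV e n j))"
        by (intro finite_measure_subadditive_finite) (auto simp: BV_ev)
      finally show ?thesis .
    qed
    have "(\<lambda>n. \<Sum>j\<in>UNIV. prob (BV e n j)) \<longlonglongrightarrow> (\<Sum>j\<in>(UNIV :: 'd set). 0)"
      by (intro tendsto_sum BV_lim e)
    then have lim: "(\<lambda>n. \<Sum>j\<in>UNIV. prob (BV e n j)) \<longlonglongrightarrow> 0" by simp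
    show ?thesis
      by (rule tendsto_sandwich[OF always_eventually[OF allI[OF measure_nonneg]]
            always_eventually[OF allI[OF le]] tendsto_const lim])
  qed
  show "\<exists>(A :: nat \<Rightarrow> 'a set) (beta_hat :: nat \<Rightarrow> 'a \<Rightarrow> real ^ 'd).
           (\<forall>n. A n \<in> sets M) \<and> (\<lambda>n. measure M (A n)) \<longlonglongrightarrow> 1 \<and>
           (\<forall>n. beta_hat n \<in> borel_measurable M) \<and>
           (\<forall>n. \<forall>\<omega>\<in>A n.
              invertible (gram n (\<lambda>i. X n i \<omega>)) \<and>
              beta_hat n \<omega> \<in> coord_box C beta_star \<and>
              phi n (lam n) (\<lambda>i. X n i \<omega>) (\<lambda>i. Y n i \<omega>) (beta_hat n \<omega>) = 0 \<and>
              (\<forall>b \<in> coord_box C beta_star.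
                 phi n (lam n) (\<lambda>i. X n i \<omega>) (\<lambda>i. Y n i \<omega>) b = 0 \<longrightarrow> b = beta_hat n \<omega>)) \<and>
           (\<forall>e>0. (\<lambda>n. measure M {\<omega> \<in> space M. dist (beta_hat n \<omega>) beta_star > e}) \<longlonglongrightarrow> 0)"
  proof (rule exI[of _ A], rule exI[of _ beta_hat], intro conjI)
    show "\<forall>n. A n \<in> sets M" using A_ev by simp
    show "(\<lambda>n. measure M (A n)) \<longlonglongrightarrow> 1" by (rule A_lim)
    show "\<forall>n. beta_hat n \<in> borel_measurable M" using beta_hat_meas by simp
    show "\<forall>e>0. (\<lambda>n. measure M {\<omega> \<in> space M. dist (beta_hat n \<omega>) beta_star > e}) \<longlonglongrightarrow> 0"
      using consistent by simp
  qed (use gram_inv box phi_iff in simp)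
qed

end
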